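(* Let $G$ be a locally compact group. Then $M_0(G)$ is finitely-generated as a left ideal of $M(G)$ if and only if $G$ is compact.
   Context: $M(G)$ is the measure algebra of $G$, i.e. the unital Banach algebra of complex regular Borel measures on $G$ with total variation norm and convolution product. The augmentation ideal is $M_0(G)=\{\mu\in M(G):\mu(G)=0\}$. A left ideal $I$ of a unital algebra $A$ is finitely-generated if there exist $n\in\mathbb{N}$ and $x_1,\ldots,x_n\in A$ with $I=Ax_1+\cdots+Ax_n$ (purely algebraically, no closure is taken). *)

theory Defs
  imports "HOL-Analysis.Analysis" "HOL-Algebra.Ring"
begin

text \<open>
  A complex Borel measure is a set function on the Borel sigma-algebra; it is extended by \<open>0\<close> to
  non-Borel sets, so that equality of measures is equality of functions.
\<close>

definition complex_borel_measure :: "('a::topological_space set \<Rightarrow> complex) \<Rightarrow> bool" where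
  "complex_borel_measure \<mu> \<longleftrightarrow>
     (\<forall>E. E \<notin> sets borel \<longrightarrow> \<mu> E = 0) \<and>
     (\<forall>A :: nat \<Rightarrow> 'a set. range A \<subseteq> sets borel \<longrightarrow> disjoint_family A \<longrightarrow>
        (\<lambda>n. \<mu> (A n)) sums \<mu> (\<Union>n. A n))"

definition total_variation :: "('a::topological_space set \<Rightarrow> complex) \<Rightarrow> 'a set \<Rightarrow> ennreal" where
  "total_variation \<mu> E =
     (SUP P \<in> {P. finite P \<and> P \<subseteq> sets borel \<and> partition_on E P}. \<Sum>A\<in>P. ennreal (cmod (\<mu> A)))"

definition regular_measure :: "('a::topological_space set \<Rightarrow> complex) \<Rightarrow> bool" where
  "regular_measure \<mu> \<longleftrightarrow>
     (\<forall>E \<in> sets borel.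
        total_variation \<mu> E = (INF U \<in> {U. open U \<and> E \<subseteq> U}. total_variation \<mu> U) \<and>
        total_variation \<mu> E = (SUP K \<in> {K. compact K \<and> K \<subseteq> E}. total_variation \<mu> K))"

text \<open>
  The positive part of a finite signed Borel measure in its Jordan decomposition,
  \<open>\<nu>\<^sup>+ E = sup {\<nu> A | A Borel, A \<subseteq> E}\<close>. Truncation of negative values by \<^const>\<open>ennreal\<close>
  is harmless, since \<open>A = {}\<close> contributes \<open>0\<close>. The negative part of \<open>\<nu>\<close> is the positive
  part of \<open>-\<nu>\<close>.
\<close>

definition positive_part :: "('a::topological_space set \<Rightarrow> real) \<Rightarrow> 'a measure" where
  "positive_part \<nu> =
     measure_of UNIV (sets borel) (\<lambda>E. SUP A \<in> {A \<in> sets borel. A \<subseteq> E}. ennreal (\<nu> A))"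

definition integral_complex_measure ::
    "('a::topological_space set \<Rightarrow> complex) \<Rightarrow> ('a \<Rightarrow> complex) \<Rightarrow> complex" where
  "integral_complex_measure \<mu> f =
     (integral\<^sup>L (positive_part (\<lambda>E. Re (\<mu> E))) f - integral\<^sup>L (positive_part (\<lambda>E. - Re (\<mu> E))) f) +
     \<i> * (integral\<^sup>L (positive_part (\<lambda>E. Im (\<mu> E))) f - integral\<^sup>L (positive_part (\<lambda>E. - Im (\<mu> E))) f)"

text \<open>
  Groups are written additively, following the class \<^class>\<open>topological_group_add\<close>, which does
  not assume commutativity. The convolution is
  \<open>(\<mu> * \<nu>)(E) = \<integral>\<integral> 1\<^sub>E(x + y) d\<nu>(y) d\<mu>(x) = \<integral> \<nu>(-x + E) d\<mu>(x)\<close>. It is stated with an iterated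
  integral, rather than as the image of a product measure under addition, because addition need
  not be measurable for the product of the Borel sigma-algebras when the group is not second
  countable. For regular \<open>\<nu>\<close> on a locally compact group, \<open>x \<mapsto> \<nu>(-x + E)\<close> is a bounded Borel
  function for every Borel set \<open>E\<close>.
\<close>

definition convolution ::
    "('a::topological_group_add set \<Rightarrow> complex) \<Rightarrow> ('a set \<Rightarrow> complex) \<Rightarrow> 'a set \<Rightarrow> complex" where
  "convolution \<mu> \<nu> E =
     (if E \<in> sets borel then integral_complex_measure \<mu> (\<lambda>x. \<nu> {y. x + y \<in> E}) else 0)"

definition point_mass :: "'a::topological_space \<Rightarrow> 'a set \<Rightarrow> complex" where
  "point_mass x E = (if E \<in> sets borel \<and> x \<in> E then 1 else 0)"

definition measure_algebra :: "('a::topological_group_add set \<Rightarrow> complex) ring" where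
  "measure_algebra =
     \<lparr>carrier = {\<mu>. complex_borel_measure \<mu> \<and> regular_measure \<mu>},
      mult = convolution,
      one = point_mass 0,
      zero = (\<lambda>E. 0),
      add = (\<lambda>\<mu> \<nu> E. \<mu> E + \<nu> E)\<rparr>"

definition augmentation_ideal :: "('a::topological_group_add set \<Rightarrow> complex) set" where
  "augmentation_ideal = {\<mu> \<in> carrier measure_algebra. \<mu> UNIV = 0}"

definition finitely_generated_left_ideal :: "('r, 'm) ring_scheme \<Rightarrow> 'r set \<Rightarrow> bool" where
  "finitely_generated_left_ideal R I \<longleftrightarrow>
     (\<exists>(n::nat) x. x \<in> {..<n} \<rightarrow> carrier R \<and>
        I = {(\<Oplus>\<^bsub>R\<^esub>i\<in>{..<n}. a i \<otimes>\<^bsub>R\<^esub> x i) | a. a \<in> {..<n} \<rightarrow> carrier R})"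

end

theory Submission
  imports Defs "HOL-Probability.Probability_Mass_Function"
begin

text \<open>
  If \<open>G\<close> is compact with normalized Haar measure \<open>\<lambda>\<close>, then \<open>\<mu> * (\<delta>\<^sub>0 - \<lambda>) = \<mu> - \<mu>(G) \<lambda>\<close>, so \<open>\<delta>\<^sub>0 - \<lambda>\<close>
  alone generates the augmentation ideal. Haar measure is constructed from covering numbers
  (\<open>invariant_content_exists\<close>), and a content is extended to a regular Borel measure by an outer
  measure (\<open>measure_of_content\<close>).

  Conversely, let \<open>x\<^sub>1, \<dots>, x\<^sub>n\<close> generate the ideal. They have total mass \<open>0\<close> and are concentrated on
  compact sets up to small errors. A sequence of compact sets \<open>B\<^sub>k\<close> can therefore grow so fast that
  \<open>\<Sum>\<^sub>k \<bar>x\<^sub>i(- g + B\<^sub>k)\<bar>\<close> is bounded uniformly in \<open>g\<close>: a translate \<open>- g + B\<^sub>k\<close> contains almost all of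
  the mass of \<open>x\<^sub>i\<close> or almost none of it, except for at most two values of \<open>k\<close>
  (\<open>slowly_varying_exhaustion\<close>). Integrating over \<open>g\<close> gives \<open>\<Sum>\<^sub>k \<bar>f(B\<^sub>k)\<bar> < \<infinity>\<close> for each
  \<open>f = \<Sum>\<^sub>i a\<^sub>i * x\<^sub>i\<close>. If \<open>G\<close> is not compact, there are points outside any finite number of the \<open>B\<^sub>k\<close>, and a
  discrete measure with slowly decaying mass at such points, minus \<open>\<delta>\<^sub>0\<close>, is an element \<open>f\<close> of
  the ideal with \<open>\<Sum>\<^sub>k \<bar>f(B\<^sub>k)\<bar> = \<infinity>\<close> (\<open>not_summable_on_exhaustion\<close>).

  Two points need care in the second half. That each \<open>x\<^sub>i\<close> lies in the ideal uses \<open>\<delta>\<^sub>0 * x\<^sub>i = x\<^sub>i\<close>,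
  hence the Borel measurability of \<open>g \<mapsto> x\<^sub>i(- g + E)\<close> (\<open>borel_measurable_left_translate\<close>). And
  rather than showing that the products \<open>a\<^sub>i * x\<^sub>i\<close> are regular measures, the proof uses that a finite
  sum in the algebra is the pointwise sum or else one fixed default value
  (\<open>finsum_measure_algebra_cases\<close>); since \<open>f\<close> and \<open>2 f\<close> cannot both be the default, this suffices.
\<close>

section \<open>Complex Borel measures\<close>

lemma complex_borel_measure_sums:
  assumes "complex_borel_measure \<mu>" "\<And>n. A n \<in> sets borel" "disjoint_family A"
  shows "(\<lambda>n. \<mu> (A n)) sums \<mu> (\<Union>n. A n)"
  using assms by (auto simp: complex_borel_measure_def image_subset_iff)

lemma complex_borel_measure_empty:
  assumes "complex_borel_measure \<mu>"
  shows "\<mu> {} = 0"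
proof -
  have "(\<lambda>n::nat. \<mu> {}) sums \<mu> (\<Union>n::nat. {})"
    by (rule complex_borel_measure_sums[OF assms]) (auto simp: disjoint_family_on_def)
  then show ?thesis
    using sums_summable summable_const_iff by blast
qed

lemma complex_borel_measure_Un:
  assumes \<mu>: "complex_borel_measure \<mu>" and AB: "A \<in> sets borel" "B \<in> sets borel" "A \<inter> B = {}"
  shows "\<mu> (A \<union> B) = \<mu> A + \<mu> B"
proof -
  have "(\<lambda>n. \<mu> (binaryset A B n)) sums \<mu> (\<Union>n. binaryset A B n)"
    by (rule complex_borel_measure_sums[OF \<mu>])
      (use AB in \<open>auto simp: binaryset_def disjoint_family_on_def\<close>)
  moreover have "(\<lambda>n. \<mu> (binaryset A B n)) sums (\<mu> A + \<mu> B)"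
    by (rule binaryset_sums) (rule complex_borel_measure_empty[OF \<mu>])
  ultimately show ?thesis
    by (simp add: UN_binaryset_eq sums_unique2)
qed

lemma complex_borel_measure_Diff:
  assumes "complex_borel_measure \<mu>" "A \<in> sets borel" "B \<in> sets borel" "B \<subseteq> A"
  shows "\<mu> (A - B) = \<mu> A - \<mu> B"
  using complex_borel_measure_Un[of \<mu> B "A - B"] assms by (simp add: Un_absorb1)

lemma complex_borel_measure_finite_UN:
  assumes \<mu>: "complex_borel_measure \<mu>" and "finite I"
    and "\<And>i. i \<in> I \<Longrightarrow> A i \<in> sets borel" "disjoint_family_on A I"
  shows "\<mu> (\<Union>i\<in>I. A i) = (\<Sum>i\<in>I. \<mu> (A i))"
  using assms(2-)
proof (induction I rule: finite_induct)
  case empty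
  then show ?case by (simp add: complex_borel_measure_empty[OF \<mu>])
next
  case (insert i I)
  have "\<mu> (A i \<union> (\<Union>j\<in>I. A j)) = \<mu> (A i) + \<mu> (\<Union>j\<in>I. A j)"
    using insert by (intro complex_borel_measure_Un[OF \<mu>]) (auto simp: disjoint_family_on_def)
  with insert show ?case
    by (auto simp: disjoint_family_on_def)
qed

lemma complex_borel_measure_add:
  assumes "complex_borel_measure \<mu>" "complex_borel_measure \<nu>"
  shows "complex_borel_measure (\<lambda>E. \<mu> E + \<nu> E)"
  using assms unfolding complex_borel_measure_def by (auto intro!: sums_add)

lemma complex_borel_measure_scale:
  assumes "complex_borel_measure \<mu>"
  shows "complex_borel_measure (\<lambda>E. c * \<mu> E)"
  using assms unfolding complex_borel_measure_def by (auto intro!: sums_mult)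

text \<open>
  Call a Borel set bad if the measure is unbounded on its Borel subsets. A bad set splits into a
  set of measure at least \<open>1\<close> in modulus and another bad set: for a subset \<open>A\<close> of \<open>E\<close> with
  \<open>\<bar>\<mu> A\<bar> > 1 + \<bar>\<mu> E\<bar>\<close> also \<open>\<bar>\<mu> (E - A)\<bar> > 1\<close>, and one of the two parts is bad. If the whole space
  were bad, iteration would give infinitely many disjoint sets whose measures do not tend to \<open>0\<close>.
\<close>

lemma complex_borel_measure_bounded:
  assumes \<mu>: "complex_borel_measure \<mu>"
  obtains C where "0 \<le> C" "\<And>E. cmod (\<mu> E) \<le> C"
proof -
  define bad where "bad E \<longleftrightarrow> E \<in> sets borel \<and> (\<forall>C. \<exists>A \<in> sets borel. A \<subseteq> E \<and> C < cmod (\<mu> A))" for E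
  have split: "\<exists>B. bad B \<and> B \<subseteq> E \<and> 1 \<le> cmod (\<mu> (E - B))" if E: "bad E" for E
  proof -
    obtain A where A: "A \<in> sets borel" "A \<subseteq> E" "1 + cmod (\<mu> E) < cmod (\<mu> A)"
      using E unfolding bad_def by blast
    have Eb: "E \<in> sets borel" using E by (simp add: bad_def)
    have "\<mu> (E - A) = \<mu> E - \<mu> A"
      by (rule complex_borel_measure_Diff[OF \<mu> Eb A(1,2)])
    then have "cmod (\<mu> (E - A)) = cmod (\<mu> A - \<mu> E)"
      by (simp add: norm_minus_commute)
    then have big: "1 \<le> cmod (\<mu> (E - A))" "1 \<le> cmod (\<mu> A)"
      using A(3) norm_triangle_ineq2[of "\<mu> A" "\<mu> E"] norm_ge_zero[of "\<mu> E"] by linarith+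
    have "bad A \<or> bad (E - A)"
    proof (rule ccontr)
      assume "\<not> (bad A \<or> bad (E - A))"
      then obtain C D where CD: "\<And>S. S \<in> sets borel \<Longrightarrow> S \<subseteq> A \<Longrightarrow> cmod (\<mu> S) \<le> C"
        "\<And>S. S \<in> sets borel \<Longrightarrow> S \<subseteq> E - A \<Longrightarrow> cmod (\<mu> S) \<le> D"
        unfolding bad_def using A(1) Eb by (metis linorder_not_le sets.Diff)
      obtain S where S: "S \<in> sets borel" "S \<subseteq> E" "C + D < cmod (\<mu> S)"
        using E unfolding bad_def by blast
      have "\<mu> S = \<mu> (S \<inter> A) + \<mu> (S - A)"
        using complex_borel_measure_Un[OF \<mu>, of "S \<inter> A" "S - A"] S(1) A(1)
        by (metis Int_Diff_Un Int_Diff_disjoint sets.Diff sets.Int)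
      moreover have "cmod (\<mu> (S \<inter> A)) \<le> C" "cmod (\<mu> (S - A)) \<le> D"
        using S A CD by blast+
      ultimately show False
        using S(3) norm_triangle_ineq[of "\<mu> (S \<inter> A)" "\<mu> (S - A)"] by simp
    qed
    then show ?thesis
      using A big by (metis Diff_subset double_diff order_refl)
  qed
  have "\<not> bad UNIV"
  proof
    assume U: "bad UNIV"
    have "\<exists>F. \<forall>n. bad (F n) \<and> (F (Suc n) \<subseteq> F n \<and> 1 \<le> cmod (\<mu> (F n - F (Suc n))))"
      by (rule dependent_nat_choice) (use U split in auto)
    then obtain F where F: "\<And>n::nat. bad (F n)" "\<And>n. F (Suc n) \<subseteq> F n"
        "\<And>n. 1 \<le> cmod (\<mu> (F n - F (Suc n)))"
      by auto
    have anti: "F n \<subseteq> F m" if "m \<le> n" for m n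
      using lift_Suc_antimono_le[of F m n] F(2) that by blast
    have "disjoint_family (\<lambda>n. F n - F (Suc n))"
      unfolding disjoint_family_on_def
    proof (intro ballI impI)
      fix m n :: nat assume "m \<noteq> n"
      then have "Suc m \<le> n \<or> Suc n \<le> m" by linarith
      then show "(F m - F (Suc m)) \<inter> (F n - F (Suc n)) = {}"
        using anti[of "Suc m" n] anti[of "Suc n" m] by blast
    qed
    then have "(\<lambda>n. \<mu> (F n - F (Suc n))) sums \<mu> (\<Union>n. F n - F (Suc n))"
      using F(1) by (intro complex_borel_measure_sums[OF \<mu>]) (auto simp: bad_def)
    then have "(\<lambda>n. \<mu> (F n - F (Suc n))) \<longlonglongrightarrow> 0"
      by (intro summable_LIMSEQ_zero) (rule sums_summable)
    from LIMSEQ_D[OF this, of 1] obtain n where "cmod (\<mu> (F n - F (Suc n))) < 1"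
      by auto
    with F(3)[of n] show False by simp
  qed
  then obtain C where C: "\<And>A. A \<in> sets borel \<Longrightarrow> cmod (\<mu> A) \<le> C"
    by (auto simp: bad_def not_less)
  have "cmod (\<mu> E) \<le> C" for E
  proof (cases "E \<in> sets borel")
    case False
    then show ?thesis
      using C[of "{}"] \<mu> complex_borel_measure_empty[OF \<mu>] by (auto simp: complex_borel_measure_def)
  qed (rule C)
  then show ?thesis
    using that[of C] norm_ge_zero order_trans by blast
qed

section \<open>Jordan decomposition and integration\<close>

lemma sets_positive_part [simp, measurable_cong]: "sets (positive_part \<nu>) = sets borel"
  and space_positive_part [simp]: "space (positive_part \<nu>) = UNIV"
  by (simp_all add: positive_part_def sigma_algebra.sigma_sets_eq[OF sets.sigma_algebra_axioms[of borel, simplified]])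

lemma emeasure_positive_part:
  assumes \<mu>: "complex_borel_measure \<mu>" and E: "E \<in> sets borel"
  shows "emeasure (positive_part (\<lambda>E. Re (\<mu> E))) E =
     (SUP A \<in> {A \<in> sets borel. A \<subseteq> E}. ennreal (Re (\<mu> A)))"
proof -
  define P where "P E = (SUP A \<in> {A \<in> sets borel. A \<subseteq> E}. ennreal (Re (\<mu> A)))" for E
  have upper: "ennreal (Re (\<mu> A)) \<le> P E" if "A \<in> sets borel" "A \<subseteq> E" for A E
    unfolding P_def using that by (auto intro!: SUP_upper)
  have P_empty: "P {} = 0"
    by (simp add: P_def complex_borel_measure_empty[OF \<mu>] cong: conj_cong)
  have super: "P A + P B \<le> P (A \<union> B)" if AB: "A \<inter> B = {}" for A B
  proof -
    let ?S = "\<lambda>E. {A \<in> sets borel. A \<subseteq> E}"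
    have ne: "?S E \<noteq> {}" for E by blast
    have "ennreal (Re (\<mu> A')) + ennreal (Re (\<mu> B')) \<le> P (A \<union> B)"
      if "A' \<in> ?S A" "B' \<in> ?S B" for A' B'
    proof -
      have u: "ennreal (Re (\<mu> A')) \<le> P (A \<union> B)" "ennreal (Re (\<mu> B')) \<le> P (A \<union> B)"
        using that by (auto intro!: upper)
      have "A' \<inter> B' = {}" using that AB by blast
      then have "\<mu> (A' \<union> B') = \<mu> A' + \<mu> B'"
        using that by (intro complex_borel_measure_Un[OF \<mu>]) auto
      moreover have "ennreal (Re (\<mu> (A' \<union> B'))) \<le> P (A \<union> B)"
        using that by (intro upper) auto
      ultimately show ?thesis
        using u by (cases "0 \<le> Re (\<mu> A')"; cases "0 \<le> Re (\<mu> B')")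
          (auto simp: ennreal_plus[symmetric] ennreal_neg simp del: ennreal_plus)
    qed
    then have "(SUP B'\<in>?S B. ennreal (Re (\<mu> A')) + ennreal (Re (\<mu> B'))) \<le> P (A \<union> B)"
      if "A' \<in> ?S A" for A'
      using that by (intro SUP_least) auto
    then have "ennreal (Re (\<mu> A')) + P B \<le> P (A \<union> B)" if "A' \<in> ?S A" for A'
      using that unfolding P_def[of B] by (subst ennreal_SUP_add_right[OF ne]) auto
    then have "(SUP A'\<in>?S A. ennreal (Re (\<mu> A')) + P B) \<le> P (A \<union> B)"
      by (intro SUP_least) auto
    then show ?thesis
      unfolding P_def[of A] by (subst ennreal_SUP_add_left[OF ne, symmetric])
  qed
  have ca: "countably_additive (sets borel) P"
    unfolding countably_additive_def
  proof (intro allI impI antisym)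
    fix F :: "nat \<Rightarrow> 'a set"
    assume F: "range F \<subseteq> sets borel" "disjoint_family F" "(\<Union>n. F n) \<in> sets borel"
    have "(\<Sum>i<n. P (F i)) \<le> P (\<Union>i<n. F i)" for n
    proof (induction n)
      case (Suc n)
      have "(\<Sum>i<Suc n. P (F i)) \<le> P (\<Union>i<n. F i) + P (F n)"
        using Suc by (simp add: add_mono)
      also have "\<dots> \<le> P ((\<Union>i<n. F i) \<union> F n)"
        using F(2) unfolding disjoint_family_on_def by (intro super) (metis (no_types, lifting) UNIV_I disjoint_iff UN_E lessThan_iff less_irrefl)
      also have "(\<Union>i<n. F i) \<union> F n = (\<Union>i<Suc n. F i)"
        by (auto simp: lessThan_Suc)
      finally show ?case .
    qed (simp add: P_empty)
    also have "P (\<Union>i<n. F i) \<le> P (\<Union>i. F i)" for n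
      unfolding P_def by (rule SUP_subset_mono) auto
    finally show "(\<Sum>i. P (F i)) \<le> P (\<Union>i. F i)"
      by (intro suminf_le_const) auto
    show "P (\<Union>i. F i) \<le> (\<Sum>i. P (F i))"
      unfolding P_def[of "\<Union>i. F i"]
    proof (rule SUP_least, clarify)
      fix A assume A: "A \<in> sets borel" "A \<subseteq> (\<Union>i. F i)"
      have "(\<lambda>n. \<mu> (A \<inter> F n)) sums \<mu> (\<Union>n. A \<inter> F n)"
      proof (rule complex_borel_measure_sums[OF \<mu>])
        show "A \<inter> F n \<in> sets borel" for n using A F by auto
        show "disjoint_family (\<lambda>n. A \<inter> F n)"
          using F(2) unfolding disjoint_family_on_def by blast
      qed
      moreover have "(\<Union>n. A \<inter> F n) = A" using A by blast
      ultimately have "(\<lambda>n. Re (\<mu> (A \<inter> F n))) sums Re (\<mu> A)"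
        by (simp add: sums_Re)
      then have "(\<lambda>n. ennreal (\<Sum>i<n. Re (\<mu> (A \<inter> F i)))) \<longlonglongrightarrow> ennreal (Re (\<mu> A))"
        unfolding sums_def by (rule tendsto_ennrealI)
      moreover have "ennreal (\<Sum>i<n. Re (\<mu> (A \<inter> F i))) \<le> (\<Sum>i. P (F i))" for n
      proof -
        have "ennreal (\<Sum>i<n. Re (\<mu> (A \<inter> F i))) \<le> ennreal (\<Sum>i<n. max 0 (Re (\<mu> (A \<inter> F i))))"
          by (intro ennreal_leI sum_mono) auto
        also have "\<dots> = (\<Sum>i<n. ennreal (max 0 (Re (\<mu> (A \<inter> F i)))))"
          by (intro sum_ennreal[symmetric]) auto
        also have "\<dots> = (\<Sum>i<n. ennreal (Re (\<mu> (A \<inter> F i))))"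
          by (intro sum.cong) (auto simp: max_def ennreal_neg)
        also have "\<dots> \<le> (\<Sum>i<n. P (F i))"
          using A F by (intro sum_mono upper) auto
        also have "\<dots> \<le> (\<Sum>i. P (F i))"
          by (intro sum_le_suminf) auto
        finally show ?thesis .
      qed
      ultimately show "ennreal (Re (\<mu> A)) \<le> (\<Sum>i. P (F i))"
        by (intro LIMSEQ_le_const2) auto
    qed
  qed
  have "positive_part (\<lambda>E. Re (\<mu> E)) = measure_of UNIV (sets borel) P"
    by (simp add: positive_part_def P_def[abs_def])
  then have "emeasure (positive_part (\<lambda>E. Re (\<mu> E))) E = P E"
    by (rule emeasure_measure_of)
      (use ca E P_empty in \<open>auto simp: positive_def\<close>)
  then show ?thesis by (simp add: P_def)
qed

lemma emeasure_positive_part_le: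
  assumes "complex_borel_measure \<mu>" "\<And>E. cmod (\<mu> E) \<le> C"
  shows "emeasure (positive_part (\<lambda>E. Re (\<mu> E))) UNIV \<le> ennreal C"
  using assms(2) emeasure_positive_part[OF assms(1), of UNIV] by (auto intro!: SUP_least ennreal_leI order_trans[OF complex_Re_le_cmod])

lemma finite_measure_positive_part:
  assumes "complex_borel_measure \<mu>"
  shows "finite_measure (positive_part (\<lambda>E. Re (\<mu> E)))"
proof -
  obtain C where "\<And>E. cmod (\<mu> E) \<le> C"
    using complex_borel_measure_bounded[OF assms] by blast
  then have "emeasure (positive_part (\<lambda>E. Re (\<mu> E))) UNIV \<le> ennreal C"
    using assms by (intro emeasure_positive_part_le)
  then show ?thesis
    by (intro finite_measureI) (auto simp: top_unique)
qed

text \<open>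
  Since \<open>\<nu> A - \<nu> E = - \<nu> (E - A)\<close>, subtracting \<open>\<nu> E\<close> from the supremum that defines the positive
  part at \<open>E\<close> gives the supremum that defines the negative part.
\<close>

lemma jordan_decomposition:
  assumes \<mu>: "complex_borel_measure \<mu>" and E: "E \<in> sets borel"
  shows "measure (positive_part (\<lambda>E. Re (\<mu> E))) E - measure (positive_part (\<lambda>E. - Re (\<mu> E))) E = Re (\<mu> E)"
proof -
  have half: "measure (positive_part (\<lambda>E. Re (\<mu> E))) E \<le>
      Re (\<mu> E) + measure (positive_part (\<lambda>E. - Re (\<mu> E))) E"
    if \<mu>: "complex_borel_measure \<mu>" for \<mu>
  proof -
    have \<mu>': "complex_borel_measure (\<lambda>E. - \<mu> E)"
      using complex_borel_measure_scale[OF \<mu>, of "-1"] by simp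
    let ?P = "positive_part (\<lambda>E. Re (\<mu> E))" and ?N = "positive_part (\<lambda>E. - Re (\<mu> E))"
    interpret P: finite_measure ?P by (rule finite_measure_positive_part[OF \<mu>])
    interpret N: finite_measure ?N using finite_measure_positive_part[OF \<mu>'] by simp
    have N: "- Re (\<mu> A) \<le> measure ?N E" if "A \<in> sets borel" "A \<subseteq> E" for A
    proof -
      have "ennreal (- Re (\<mu> A)) \<le> emeasure ?N E"
        using emeasure_positive_part[OF \<mu>' E] that by (auto intro!: SUP_upper)
      then show ?thesis
        by (simp add: N.emeasure_eq_measure)
    qed
    have "emeasure ?P E \<le> ennreal (Re (\<mu> E) + measure ?N E)"
      unfolding emeasure_positive_part[OF \<mu> E]
    proof (rule SUP_least, clarify)
      fix A assume A: "A \<in> sets borel" "A \<subseteq> E"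
      show "ennreal (Re (\<mu> A)) \<le> ennreal (Re (\<mu> E) + measure ?N E)"
        using N[of "E - A"] complex_borel_measure_Diff[OF \<mu> E A] A E by (intro ennreal_leI) auto
    qed
    moreover have "0 \<le> Re (\<mu> E) + measure ?N E"
      using N[OF E] by simp
    ultimately show ?thesis
      by (simp add: P.emeasure_eq_measure)
  qed
  have \<mu>': "complex_borel_measure (\<lambda>E. - \<mu> E)"
    using complex_borel_measure_scale[OF \<mu>, of "-1"] by simp
  show ?thesis
    using half[OF \<mu>] half[OF \<mu>'] by simp
qed

lemma integral_complex_measure_affine_indicator:
  assumes \<mu>: "complex_borel_measure \<mu>" and E: "E \<in> sets borel"
  shows "integral_complex_measure \<mu> (\<lambda>x. indicator E x + c) = \<mu> E + c * \<mu> UNIV"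
proof -
  have one: "integral\<^sup>L (positive_part (\<lambda>E. Re (\<nu> E))) (\<lambda>x. indicator E x + c) =
      of_real (measure (positive_part (\<lambda>E. Re (\<nu> E))) E) +
      c * of_real (measure (positive_part (\<lambda>E. Re (\<nu> E))) UNIV)"
    if "complex_borel_measure \<nu>" for \<nu>
  proof -
    interpret finite_measure "positive_part (\<lambda>E. Re (\<nu> E))"
      by (rule finite_measure_positive_part[OF that])
    let ?P = "positive_part (\<lambda>E. Re (\<nu> E))"
    have "has_bochner_integral ?P (\<lambda>x. indicator E x *\<^sub>R (1::complex)) (measure ?P E *\<^sub>R 1)"
      using E by (intro has_bochner_integral_indicator) (auto simp: less_top[symmetric])
    moreover have "(\<lambda>x. indicator E x *\<^sub>R (1::complex)) = indicator E"
      by (auto simp: indicator_def)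
    ultimately have *: "has_bochner_integral ?P (indicator E) (complex_of_real (measure ?P E))"
      by (metis (no_types, lifting) scaleR_conv_of_real mult.right_neutral)
    show ?thesis
      using integrable.intros[OF *] has_bochner_integral_integral_eq[OF *]
      by (simp add: scaleR_conv_of_real mult.commute)
  qed
  have m: "complex_borel_measure (\<lambda>E. - \<mu> E)" "complex_borel_measure (\<lambda>E. - \<i> * \<mu> E)"
      "complex_borel_measure (\<lambda>E. \<i> * \<mu> E)"
    using complex_borel_measure_scale[OF \<mu>, of "-1"] complex_borel_measure_scale[OF \<mu>, of "-\<i>"]
      complex_borel_measure_scale[OF \<mu>, of "\<i>"] by simp_all
  have j: "measure (positive_part (\<lambda>E. Re (\<mu> E))) A = Re (\<mu> A) + measure (positive_part (\<lambda>E. - Re (\<mu> E))) A"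
     "measure (positive_part (\<lambda>E. Im (\<mu> E))) A = Im (\<mu> A) + measure (positive_part (\<lambda>E. - Im (\<mu> E))) A"
     if "A \<in> sets borel" for A
    using jordan_decomposition[OF \<mu> that] jordan_decomposition[OF m(2) that] by simp_all
  show ?thesis
    unfolding integral_complex_measure_def
    using one[OF \<mu>] one[OF m(1)] one[OF m(2)] one[OF m(3)] j[OF E] j[of UNIV]
    by (simp add: complex_eq_iff algebra_simps)
qed

section \<open>Total variation and regularity\<close>

text \<open>
  Unlike the parts of a partition, the sets of a family may be empty and need not cover \<open>E\<close>, so
  traces \<open>X \<inter> A\<close> of a partition form an admissible family.
\<close>

lemma sum_le_total_variation:
  assumes \<mu>: "complex_borel_measure \<mu>" and "finite I" and E: "E \<in> sets borel"
    and A: "\<And>i. i \<in> I \<Longrightarrow> A i \<in> sets borel" "\<And>i. i \<in> I \<Longrightarrow> A i \<subseteq> E" "disjoint_family_on A I"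
  shows "(\<Sum>i\<in>I. ennreal (cmod (\<mu> (A i)))) \<le> total_variation \<mu> E"
proof -
  define J where "J = {i \<in> I. A i \<noteq> {}}"
  define R where "R = E - (\<Union>i\<in>I. A i)"
  define P where "P = A ` J \<union> ({R} - {{}})"
  have J: "finite J" "J \<subseteq> I" using \<open>finite I\<close> by (auto simp: J_def)
  have inj: "inj_on A J"
    using A(3) unfolding inj_on_def J_def disjoint_family_on_def by blast
  have fin: "finite P" using J by (auto simp: P_def)
  have P: "P \<subseteq> sets borel" "partition_on E P"
  proof -
    have "R \<in> sets borel"
      unfolding R_def using E A(1) \<open>finite I\<close> by (intro sets.Diff sets.finite_UN) auto
    moreover have "A ` J \<subseteq> sets borel" using A(1) J(2) by blast
    ultimately show "P \<subseteq> sets borel" by (auto simp: P_def)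
    show "partition_on E P"
    proof (rule partition_onI)
      have "(\<Union>i\<in>I. A i) \<subseteq> E" by (rule UN_least) (rule A(2))
      then have "\<Union>(A ` I) \<union> R = E" by (simp add: R_def Un_absorb1)
      moreover have "\<Union>(A ` I) = \<Union>(A ` J)" by (auto simp: J_def)
      ultimately show "\<Union>P = E" by (auto simp: P_def)
      show "{} \<notin> P" by (auto simp: P_def J_def)
      fix X Y assume XY: "X \<in> P" "Y \<in> P" "X \<noteq> Y"
      have 1: "disjnt (A i) (A j)" if "i \<in> J" "j \<in> J" "A i \<noteq> A j" for i j
        using that A(3) J(2) unfolding disjnt_def disjoint_family_on_def by (metis subsetD)
      have 2: "disjnt (A i) R" "disjnt R (A i)" if "i \<in> J" for i
        using that J(2) by (auto simp: R_def disjnt_def)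
      have "X = R \<or> X \<in> A ` J" "Y = R \<or> Y \<in> A ` J"
        using XY by (auto simp: P_def)
      then show "disjnt X Y"
        using XY(3) 1 2 by (elim disjE imageE) simp_all
    qed
  qed
  have "(\<Sum>i\<in>I. ennreal (cmod (\<mu> (A i)))) = (\<Sum>i\<in>J. ennreal (cmod (\<mu> (A i))))"
    using complex_borel_measure_empty[OF \<mu>] \<open>finite I\<close>
    by (intro sum.mono_neutral_right) (auto simp: J_def)
  also have "\<dots> = (\<Sum>X\<in>A ` J. ennreal (cmod (\<mu> X)))"
    by (simp add: sum.reindex[OF inj])
  also have "\<dots> \<le> (\<Sum>X\<in>P. ennreal (cmod (\<mu> X)))"
    using fin by (intro sum_mono2) (auto simp: P_def)
  also have "\<dots> \<le> total_variation \<mu> E"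
    unfolding total_variation_def using fin P by (intro SUP_upper) auto
  finally show ?thesis .
qed

lemma total_variation_leI:
  assumes "\<And>P. finite P \<Longrightarrow> P \<subseteq> sets borel \<Longrightarrow> partition_on E P \<Longrightarrow> (\<Sum>X\<in>P. ennreal (cmod (\<mu> X))) \<le> c"
  shows "total_variation \<mu> E \<le> c"
  unfolding total_variation_def using assms by (auto intro!: SUP_least)

lemma partition_on_imp_disjoint_family_on:
  "partition_on E P \<Longrightarrow> (\<And>X. X \<in> P \<Longrightarrow> f X \<subseteq> X) \<Longrightarrow> disjoint_family_on f P"
  unfolding partition_on_def disjoint_family_on_def disjoint_def by blast

lemma cmod_le_total_variation:
  assumes "complex_borel_measure \<mu>" "A \<in> sets borel" "E \<in> sets borel" "A \<subseteq> E"
  shows "ennreal (cmod (\<mu> A)) \<le> total_variation \<mu> E"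
  using sum_le_total_variation[OF assms(1), of "{()}" E "\<lambda>_. A"] assms
  by (auto simp: disjoint_family_on_def)

lemma total_variation_Un:
  assumes \<mu>: "complex_borel_measure \<mu>" and A: "A \<in> sets borel" and B: "B \<in> sets borel" and AB: "A \<inter> B = {}"
  shows "total_variation \<mu> (A \<union> B) = total_variation \<mu> A + total_variation \<mu> B"
proof (rule antisym)
  show "total_variation \<mu> (A \<union> B) \<le> total_variation \<mu> A + total_variation \<mu> B"
  proof (rule total_variation_leI)
    fix P assume P: "finite P" "P \<subseteq> sets borel" "partition_on (A \<union> B) P"
    have "cmod (\<mu> X) \<le> cmod (\<mu> (X \<inter> A)) + cmod (\<mu> (X \<inter> B))" if "X \<in> P" for X
    proof -
      have "X = (X \<inter> A) \<union> (X \<inter> B)" using that P(3) by (auto simp: partition_on_def)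
      moreover have "\<mu> ((X \<inter> A) \<union> (X \<inter> B)) = \<mu> (X \<inter> A) + \<mu> (X \<inter> B)"
        using that P A B AB by (intro complex_borel_measure_Un[OF \<mu>]) auto
      ultimately show ?thesis
        by (metis norm_triangle_ineq)
    qed
    then have "(\<Sum>X\<in>P. ennreal (cmod (\<mu> X)))
        \<le> (\<Sum>X\<in>P. ennreal (cmod (\<mu> (X \<inter> A))) + ennreal (cmod (\<mu> (X \<inter> B))))"
      by (intro sum_mono) (auto simp: ennreal_plus[symmetric] simp del: ennreal_plus intro!: ennreal_leI)
    also have "\<dots> \<le> total_variation \<mu> A + total_variation \<mu> B"
      unfolding sum.distrib using P A B
      by (intro add_mono sum_le_total_variation[OF \<mu>] partition_on_imp_disjoint_family_on[OF P(3)]) auto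
    finally show "(\<Sum>X\<in>P. ennreal (cmod (\<mu> X))) \<le> total_variation \<mu> A + total_variation \<mu> B" .
  qed
  let ?S = "\<lambda>E. {P. finite P \<and> P \<subseteq> sets borel \<and> partition_on E P}"
  have ne: "?S E \<noteq> {}" if "E \<in> sets borel" for E :: "'a set"
  proof -
    have "{E} - {{}} \<in> ?S E" using that by (auto simp: partition_on_def disjoint_def)
    then show ?thesis by blast
  qed
  have "(\<Sum>X\<in>P. ennreal (cmod (\<mu> X))) + (\<Sum>X\<in>Q. ennreal (cmod (\<mu> X))) \<le> total_variation \<mu> (A \<union> B)"
    if P: "P \<in> ?S A" and Q: "Q \<in> ?S B" for P Q
  proof -
    have sub: "X \<subseteq> A" "X \<noteq> {}" if "X \<in> P" for X using that P by (auto simp: partition_on_def)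
    have sub': "X \<subseteq> B" if "X \<in> Q" for X using that Q by (auto simp: partition_on_def)
    have disj: "disjoint_family_on (\<lambda>X. X) (P \<union> Q)"
      unfolding disjoint_family_on_def
    proof (intro ballI impI)
      fix X Y assume XY: "X \<in> P \<union> Q" "Y \<in> P \<union> Q" "X \<noteq> Y"
      have PQ: "X \<inter> Y = {}" if "X \<in> P" "Y \<in> Q" for X Y
        using sub(1)[OF that(1)] sub'[OF that(2)] AB by blast
      have "disjoint P" "disjoint Q" using P Q by (auto simp: partition_on_def)
      then show "X \<inter> Y = {}"
        using XY(1,2)
        by (elim UnE) (use XY(3) PQ[of X Y] PQ[of Y X] in \<open>simp_all add: disjointD Int_commute\<close>)
    qed
    have "P \<inter> Q = {}" using sub sub' AB by blast
    then have "(\<Sum>X\<in>P. ennreal (cmod (\<mu> X))) + (\<Sum>X\<in>Q. ennreal (cmod (\<mu> X)))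
        = (\<Sum>X\<in>P \<union> Q. ennreal (cmod (\<mu> X)))"
      using P Q by (intro sum.union_disjoint[symmetric]) auto
    also have "\<dots> \<le> total_variation \<mu> (A \<union> B)"
      using P Q A B disj sub sub' by (intro sum_le_total_variation[OF \<mu>]) auto
    finally show ?thesis .
  qed
  then have "(\<Sum>X\<in>P. ennreal (cmod (\<mu> X))) + total_variation \<mu> B \<le> total_variation \<mu> (A \<union> B)"
    if "P \<in> ?S A" for P
    using that unfolding total_variation_def[of \<mu> B] ennreal_SUP_add_right[OF ne[OF B]]
    by (intro SUP_least) auto
  then show "total_variation \<mu> A + total_variation \<mu> B \<le> total_variation \<mu> (A \<union> B)"
    unfolding total_variation_def[of \<mu> A] ennreal_SUP_add_left[OF ne[OF A], symmetric]
    by (intro SUP_least) auto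
qed

lemma total_variation_Diff_add:
  assumes "complex_borel_measure \<mu>" "A \<in> sets borel" "B \<in> sets borel" "A \<subseteq> B"
  shows "total_variation \<mu> B = total_variation \<mu> (B - A) + total_variation \<mu> A"
  using total_variation_Un[of \<mu> "B - A" A] assms by (simp add: Un_absorb2 Diff_disjoint[THEN trans[OF Int_commute]])

lemma total_variation_mono:
  assumes "complex_borel_measure \<mu>" "A \<in> sets borel" "B \<in> sets borel" "A \<subseteq> B"
  shows "total_variation \<mu> A \<le> total_variation \<mu> B"
  unfolding total_variation_Diff_add[OF assms] by simp

text \<open>
  On the sets of a partition where a real measure is nonnegative its absolute values add up to a
  single value of the measure, and likewise where it is negative. Applied to real and imaginary part,
  this bounds the variation by four times a bound of the measure.
\<close>

lemma total_variation_finite: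
  assumes \<mu>: "complex_borel_measure \<mu>"
  shows "total_variation \<mu> E < \<infinity>"
proof -
  obtain C where C: "0 \<le> C" "\<And>E. cmod (\<mu> E) \<le> C"
    using complex_borel_measure_bounded[OF \<mu>] by blast
  have "total_variation \<mu> E \<le> ennreal (4 * C)"
  proof (rule total_variation_leI)
    fix P assume P: "finite P" "P \<subseteq> sets borel" "partition_on E P"
    have half: "(\<Sum>X\<in>P. \<bar>Re (c * \<mu> X)\<bar>) \<le> 2 * C" if c: "cmod c = 1" for c
    proof -
      let ?p = "{X\<in>P. 0 \<le> Re (c * \<mu> X)}" and ?n = "{X\<in>P. \<not> 0 \<le> Re (c * \<mu> X)}"
      have part: "\<bar>\<Sum>X\<in>Q. Re (c * \<mu> X)\<bar> \<le> C" if "Q \<subseteq> P" for Q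
      proof -
        have "\<mu> (\<Union>X\<in>Q. X) = (\<Sum>X\<in>Q. \<mu> X)"
          using that P partition_on_imp_disjoint_family_on[OF P(3), of "\<lambda>X. X"]
          by (intro complex_borel_measure_finite_UN[OF \<mu>])
            (auto intro: finite_subset disjoint_family_on_mono)
        then have "(\<Sum>X\<in>Q. Re (c * \<mu> X)) = Re (c * \<mu> (\<Union>X\<in>Q. X))"
          by (simp only: sum_distrib_left Re_sum)
        also have "\<bar>\<dots>\<bar> \<le> cmod (c * \<mu> (\<Union>X\<in>Q. X))"
          by (rule abs_Re_le_cmod)
        also have "\<dots> \<le> C" using C c by (simp add: norm_mult)
        finally show ?thesis .
      qed
      have "(\<Sum>X\<in>P. \<bar>Re (c * \<mu> X)\<bar>) = (\<Sum>X\<in>?p. \<bar>Re (c * \<mu> X)\<bar>) + (\<Sum>X\<in>?n. \<bar>Re (c * \<mu> X)\<bar>)"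
        using P(1) by (subst sum.union_disjoint[symmetric]) (auto intro!: sum.cong)
      also have "(\<Sum>X\<in>?p. \<bar>Re (c * \<mu> X)\<bar>) = (\<Sum>X\<in>?p. Re (c * \<mu> X))"
        by (intro sum.cong) auto
      also have "(\<Sum>X\<in>?n. \<bar>Re (c * \<mu> X)\<bar>) = (\<Sum>X\<in>?n. - Re (c * \<mu> X))"
        by (intro sum.cong) auto
      also have "\<dots> = - (\<Sum>X\<in>?n. Re (c * \<mu> X))"
        by (rule sum_negf)
      finally show ?thesis
        using part[of ?p] part[of ?n] by (auto simp del: times_complex.sel)
    qed
    have "(\<Sum>X\<in>P. cmod (\<mu> X)) \<le> (\<Sum>X\<in>P. \<bar>Re (1 * \<mu> X)\<bar> + \<bar>Re (-\<i> * \<mu> X)\<bar>)"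
      by (intro sum_mono) (simp add: cmod_le)
    also have "\<dots> \<le> 4 * C"
      using half[of 1] half[of "-\<i>"] by (simp add: sum.distrib)
    finally show "(\<Sum>X\<in>P. ennreal (cmod (\<mu> X))) \<le> ennreal (4 * C)"
      by (simp add: sum_ennreal ennreal_leI)
  qed
  then show ?thesis
    by (rule le_less_trans) (simp add: infinity_ennreal_def)
qed

text \<open>
  Since the variation is finite and additive, regularity says that \<open>E\<close> is enclosed between a compact
  and an open set whose difference has small variation. This form passes to sums and to dominated
  measures.
\<close>

lemma regular_measure_iff:
  fixes \<mu> :: "'a::t2_space set \<Rightarrow> complex"
  assumes \<mu>: "complex_borel_measure \<mu>"
  shows "regular_measure \<mu> \<longleftrightarrow>
    (\<forall>E\<in>sets borel. \<forall>e>0. \<exists>K U. compact K \<and> K \<subseteq> E \<and> open U \<and> E \<subseteq> U \<and>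
       total_variation \<mu> (U - K) < ennreal e)"
proof
  assume reg: "regular_measure \<mu>"
  show "\<forall>E\<in>sets borel. \<forall>e>0. \<exists>K U. compact K \<and> K \<subseteq> E \<and> open U \<and> E \<subseteq> U \<and>
       total_variation \<mu> (U - K) < ennreal e"
  proof (intro ballI allI impI)
    fix E :: "'a set" and e :: real assume E: "E \<in> sets borel" and e: "0 < e"
    let ?t = "total_variation \<mu> E"
    have fin: "?t < \<infinity>" by (rule total_variation_finite[OF \<mu>])
    have inf: "?t = (INF U \<in> {U. open U \<and> E \<subseteq> U}. total_variation \<mu> U)"
      and sup: "?t = (SUP K \<in> {K. compact K \<and> K \<subseteq> E}. total_variation \<mu> K)"
      using reg E unfolding regular_measure_def by blast+
    have "?t < ?t + ennreal (e/2)"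
      using fin e by (cases ?t) (auto simp: ennreal_less_iff simp flip: ennreal_plus)
    then obtain U where U: "open U" "E \<subseteq> U" "total_variation \<mu> U < ?t + ennreal (e/2)"
      using inf INF_less_iff[of "total_variation \<mu>" "{U. open U \<and> E \<subseteq> U}"] by auto
    obtain K where K: "compact K" "K \<subseteq> E" "?t < total_variation \<mu> K + ennreal (e/2)"
    proof (cases "?t = 0")
      case True
      then show ?thesis using that[of "{}"] e by (simp add: add_nonneg_pos)
    next
      case False
      then have "?t - ennreal (e/2) < ?t"
        using fin e by (intro ennreal_between) (auto simp: zero_less_iff_neq_zero)
      then obtain K where K: "compact K" "K \<subseteq> E" "?t - ennreal (e/2) < total_variation \<mu> K"
        using sup less_SUP_iff[of _ "total_variation \<mu>" "{K. compact K \<and> K \<subseteq> E}"] by auto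
      then have "?t < total_variation \<mu> K + ennreal (e/2)"
      proof -
        obtain r k where "0 \<le> r" "?t = ennreal r" "0 \<le> k" "total_variation \<mu> K = ennreal k"
          using fin total_variation_finite[OF \<mu>, of K]
          by (metis ennreal_cases infinity_ennreal_def less_irrefl)
        with K(3) e show ?thesis
          using ennreal_leI[of k "r - e/2"]
          by (auto simp: ennreal_minus ennreal_less_iff not_le[symmetric] simp flip: ennreal_plus)
      qed
      with K that show ?thesis by blast
    qed
    have "K \<in> sets borel" "U \<in> sets borel" using K(1) U(1) by (auto intro: borel_compact)
    then have "total_variation \<mu> U = total_variation \<mu> (U - K) + total_variation \<mu> K"
      using K U by (intro total_variation_Diff_add[OF \<mu>]) auto
    moreover have "total_variation \<mu> (U - K) < \<infinity>" "total_variation \<mu> K < \<infinity>"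
      by (rule total_variation_finite[OF \<mu>])+
    ultimately have "total_variation \<mu> (U - K) < ennreal e"
      using U(3) K(3) fin e
      by (cases "total_variation \<mu> (U - K)"; cases "total_variation \<mu> K"; cases ?t)
        (auto simp: ennreal_plus[symmetric] ennreal_less_iff simp del: ennreal_plus)
    with K U show "\<exists>K U. compact K \<and> K \<subseteq> E \<and> open U \<and> E \<subseteq> U \<and> total_variation \<mu> (U - K) < ennreal e"
      by blast
  qed
next
  assume eps: "\<forall>E\<in>sets borel. \<forall>e>0. \<exists>K U. compact K \<and> K \<subseteq> E \<and> open U \<and> E \<subseteq> U \<and>
       total_variation \<mu> (U - K) < ennreal e"
  show "regular_measure \<mu>"
    unfolding regular_measure_def
  proof (intro ballI conjI antisym)
    fix E :: "'a set" assume E: "E \<in> sets borel"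
    show "total_variation \<mu> E \<le> (INF U \<in> {U. open U \<and> E \<subseteq> U}. total_variation \<mu> U)"
    proof (rule INF_greatest)
      fix U assume "U \<in> {U. open U \<and> E \<subseteq> U}"
      with E show "total_variation \<mu> E \<le> total_variation \<mu> U"
        by (intro total_variation_mono[OF \<mu>]) simp_all
    qed
    show "(SUP K \<in> {K. compact K \<and> K \<subseteq> E}. total_variation \<mu> K) \<le> total_variation \<mu> E"
    proof (rule SUP_least)
      fix K assume K: "K \<in> {K. compact K \<and> K \<subseteq> E}"
      then have "K \<in> sets borel" by (simp add: borel_compact)
      with K E show "total_variation \<mu> K \<le> total_variation \<mu> E"
        by (intro total_variation_mono[OF \<mu>]) simp_all
    qed
    show "(INF U \<in> {U. open U \<and> E \<subseteq> U}. total_variation \<mu> U) \<le> total_variation \<mu> E"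
    proof (rule ennreal_le_epsilon)
      fix e :: real assume "0 < e"
      then obtain K U where KU: "compact K" "K \<subseteq> E" "open U" "E \<subseteq> U" "total_variation \<mu> (U - K) < ennreal e"
        using eps[rule_format, OF E, of e] by metis
      have KU': "K \<in> sets borel" "U \<in> sets borel" using KU by (auto intro: borel_compact)
      have "total_variation \<mu> U = total_variation \<mu> (U - E) + total_variation \<mu> E"
        using KU KU' E by (intro total_variation_Diff_add[OF \<mu>]) auto
      also have "\<dots> \<le> total_variation \<mu> (U - K) + total_variation \<mu> E"
        using KU KU' E by (intro add_right_mono total_variation_mono[OF \<mu>]) auto
      also have "\<dots> \<le> total_variation \<mu> E + ennreal e"
        using KU(5) by (subst add.commute) (intro add_left_mono, auto)
      finally show "(INF U \<in> {U. open U \<and> E \<subseteq> U}. total_variation \<mu> U) \<le> total_variation \<mu> E + ennreal e"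
        using KU(3,4) by (intro INF_lower2[of U]) auto
    qed
    show "total_variation \<mu> E \<le> (SUP K \<in> {K. compact K \<and> K \<subseteq> E}. total_variation \<mu> K)"
    proof (rule ennreal_le_epsilon)
      fix e :: real assume "0 < e"
      then obtain K U where KU: "compact K" "K \<subseteq> E" "open U" "E \<subseteq> U" "total_variation \<mu> (U - K) < ennreal e"
        using eps[rule_format, OF E, of e] by metis
      have KU': "K \<in> sets borel" "U \<in> sets borel" using KU by (auto intro: borel_compact)
      have "total_variation \<mu> E = total_variation \<mu> (E - K) + total_variation \<mu> K"
        using KU KU' E by (intro total_variation_Diff_add[OF \<mu>]) auto
      also have "\<dots> \<le> total_variation \<mu> (U - K) + total_variation \<mu> K"
        using KU KU' E by (intro add_right_mono total_variation_mono[OF \<mu>]) auto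
      also have "\<dots> \<le> (SUP K \<in> {K. compact K \<and> K \<subseteq> E}. total_variation \<mu> K) + ennreal e"
        using KU(1,2,5) by (subst add.commute) (intro add_mono SUP_upper, auto)
      finally show "total_variation \<mu> E \<le> (SUP K \<in> {K. compact K \<and> K \<subseteq> E}. total_variation \<mu> K) + ennreal e" .
    qed
  qed
qed

lemma mem_carrier_measure_algebra:
  "\<mu> \<in> carrier measure_algebra \<longleftrightarrow> complex_borel_measure \<mu> \<and> regular_measure \<mu>"
  by (simp add: measure_algebra_def)

lemma carrier_measure_algebra_add:
  fixes \<mu> \<nu> :: "'a::{topological_group_add, t2_space} set \<Rightarrow> complex"
  assumes "\<mu> \<in> carrier measure_algebra" "\<nu> \<in> carrier measure_algebra"
  shows "(\<lambda>E. \<mu> E + \<nu> E) \<in> carrier measure_algebra"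
proof -
  have \<mu>: "complex_borel_measure \<mu>" "regular_measure \<mu>" and \<nu>: "complex_borel_measure \<nu>" "regular_measure \<nu>"
    using assms by (auto simp: mem_carrier_measure_algebra)
  have sum: "complex_borel_measure (\<lambda>E. \<mu> E + \<nu> E)"
    by (rule complex_borel_measure_add[OF \<mu>(1) \<nu>(1)])
  have tv: "total_variation (\<lambda>E. \<mu> E + \<nu> E) E \<le> total_variation \<mu> E + total_variation \<nu> E"
    if E: "E \<in> sets borel" for E
  proof (rule total_variation_leI)
    fix P assume P: "finite P" "P \<subseteq> sets borel" "partition_on E P"
    then have sub: "X \<subseteq> E" if "X \<in> P" for X using that by (auto simp: partition_on_def)
    have "(\<Sum>X\<in>P. ennreal (cmod (\<mu> X + \<nu> X))) \<le> (\<Sum>X\<in>P. ennreal (cmod (\<mu> X)) + ennreal (cmod (\<nu> X)))"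
      by (intro sum_mono)
        (auto simp: ennreal_plus[symmetric] simp del: ennreal_plus intro!: ennreal_leI norm_triangle_ineq)
    also have "\<dots> \<le> total_variation \<mu> E + total_variation \<nu> E"
      unfolding sum.distrib using P sub E
      by (intro add_mono sum_le_total_variation \<mu> \<nu> partition_on_imp_disjoint_family_on[OF P(3)]) auto
    finally show "(\<Sum>X\<in>P. ennreal (cmod (\<mu> X + \<nu> X))) \<le> total_variation \<mu> E + total_variation \<nu> E" .
  qed
  have "regular_measure (\<lambda>E. \<mu> E + \<nu> E)"
    unfolding regular_measure_iff[OF sum]
  proof (intro ballI allI impI)
    fix E :: "'a set" and e :: real assume E: "E \<in> sets borel" and e: "0 < e"
    obtain K U where KU: "compact K" "K \<subseteq> E" "open U" "E \<subseteq> U" "total_variation \<mu> (U - K) < ennreal (e/2)"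
      using \<mu>(2)[unfolded regular_measure_iff[OF \<mu>(1)]] E e by (meson half_gt_zero)
    obtain L V where LV: "compact L" "L \<subseteq> E" "open V" "E \<subseteq> V" "total_variation \<nu> (V - L) < ennreal (e/2)"
      using \<nu>(2)[unfolded regular_measure_iff[OF \<nu>(1)]] E e by (meson half_gt_zero)
    have b: "K \<in> sets borel" "L \<in> sets borel" "U \<in> sets borel" "V \<in> sets borel"
      using KU LV by (auto intro: borel_compact)
    have "total_variation (\<lambda>E. \<mu> E + \<nu> E) (U \<inter> V - (K \<union> L))
        \<le> total_variation \<mu> (U \<inter> V - (K \<union> L)) + total_variation \<nu> (U \<inter> V - (K \<union> L))"
      using b by (intro tv) auto
    also have "\<dots> \<le> total_variation \<mu> (U - K) + total_variation \<nu> (V - L)"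
      using b by (intro add_mono total_variation_mono \<mu> \<nu>) auto
    also have "\<dots> < ennreal (e/2) + ennreal (e/2)"
      using KU LV by (intro add_strict_mono)
    also have "\<dots> = ennreal e"
      using e by (simp flip: ennreal_plus)
    finally have "total_variation (\<lambda>E. \<mu> E + \<nu> E) (U \<inter> V - (K \<union> L)) < ennreal e" .
    moreover have "compact (K \<union> L)" "K \<union> L \<subseteq> E" "open (U \<inter> V)" "E \<subseteq> U \<inter> V"
      using KU(1-4) LV(1-4) by auto
    ultimately show "\<exists>K U. compact K \<and> K \<subseteq> E \<and> open U \<and> E \<subseteq> U \<and>
        total_variation (\<lambda>E. \<mu> E + \<nu> E) (U - K) < ennreal e"
      by meson
  qed
  with sum show ?thesis by (simp add: mem_carrier_measure_algebra)
qed

lemma carrier_measure_algebra_scale: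
  fixes \<mu> :: "'a::{topological_group_add, t2_space} set \<Rightarrow> complex"
  assumes "\<mu> \<in> carrier measure_algebra"
  shows "(\<lambda>E. c * \<mu> E) \<in> carrier measure_algebra"
proof -
  have \<mu>: "complex_borel_measure \<mu>" "regular_measure \<mu>"
    using assms by (auto simp: mem_carrier_measure_algebra)
  have tv: "total_variation (\<lambda>E. c * \<mu> E) E = ennreal (cmod c) * total_variation \<mu> E" for E
    unfolding total_variation_def
    by (simp add: norm_mult ennreal_mult sum_distrib_left[symmetric] SUP_mult_left_ennreal)
  have c: "complex_borel_measure (\<lambda>E. c * \<mu> E)"
    by (rule complex_borel_measure_scale[OF \<mu>(1)])
  have "regular_measure (\<lambda>E. c * \<mu> E)"
    unfolding regular_measure_iff[OF c]
  proof (intro ballI allI impI)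
    fix E :: "'a set" and e :: real assume E: "E \<in> sets borel" and e: "0 < e"
    define d where "d = e / (cmod c + 1)"
    have d: "0 < d" "cmod c * d < e"
      using e by (auto simp: d_def field_simps add_pos_nonneg)
    obtain K U where KU: "compact K" "K \<subseteq> E" "open U" "E \<subseteq> U" "total_variation \<mu> (U - K) < ennreal d"
      using \<mu>(2)[unfolded regular_measure_iff[OF \<mu>(1)]] E d(1) by meson
    have "total_variation (\<lambda>E. c * \<mu> E) (U - K) \<le> ennreal (cmod c) * ennreal d"
      unfolding tv using KU(5) by (intro mult_left_mono) auto
    also have "\<dots> < ennreal e"
      using d e by (simp add: ennreal_less_iff flip: ennreal_mult)
    finally show "\<exists>K U. compact K \<and> K \<subseteq> E \<and> open U \<and> E \<subseteq> U \<and>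
        total_variation (\<lambda>E. c * \<mu> E) (U - K) < ennreal e"
      using KU by blast
  qed
  with c show ?thesis by (simp add: mem_carrier_measure_algebra)
qed

text \<open>The measure of a set outside the sigma-algebra is \<open>0\<close>, as required of a complex Borel measure.\<close>

definition of_measure :: "'a::topological_space measure \<Rightarrow> 'a set \<Rightarrow> complex" where
  "of_measure m E = complex_of_real (measure m E)"

lemma of_measure_in_carrier:
  fixes m :: "'a::{topological_group_add, t2_space} measure"
  assumes m: "finite_measure m" and sets: "sets m = sets borel"
    and eps: "\<And>E e. E \<in> sets borel \<Longrightarrow> 0 < e \<Longrightarrow>
      \<exists>K U. compact K \<and> K \<subseteq> E \<and> open U \<and> E \<subseteq> U \<and> measure m (U - K) < e"
  shows "of_measure m \<in> carrier measure_algebra"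
proof -
  interpret finite_measure m by fact
  have c: "complex_borel_measure (of_measure m)"
    unfolding complex_borel_measure_def
  proof (intro conjI allI impI)
    show "of_measure m E = 0" if "E \<notin> sets borel" for E
      using that sets by (simp add: of_measure_def measure_notin_sets)
    show "(\<lambda>n. of_measure m (A n)) sums of_measure m (\<Union>n. A n)"
      if "range A \<subseteq> sets borel" "disjoint_family A" for A :: "nat \<Rightarrow> 'a set"
      unfolding of_measure_def using that sets by (intro sums_of_real finite_measure_UNION) auto
  qed
  have tv: "total_variation (of_measure m) E \<le> ennreal (measure m E)" for E
  proof (rule total_variation_leI)
    fix P assume P: "finite P" "P \<subseteq> sets borel" "partition_on E P"
    have "of_measure m (\<Union>X\<in>P. X) = (\<Sum>X\<in>P. of_measure m X)"
      using P by (intro complex_borel_measure_finite_UN[OF c] partition_on_imp_disjoint_family_on[OF P(3)]) auto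
    moreover have "(\<Union>X\<in>P. X) = E" using P by (auto simp: partition_on_def)
    ultimately have "measure m E = (\<Sum>X\<in>P. measure m X)"
      by (simp add: of_measure_def flip: of_real_sum)
    then show "(\<Sum>X\<in>P. ennreal (cmod (of_measure m X))) \<le> ennreal (measure m E)"
      by (simp add: of_measure_def sum_ennreal)
  qed
  have "regular_measure (of_measure m)"
    unfolding regular_measure_iff[OF c]
  proof (intro ballI allI impI)
    fix E :: "'a set" and e :: real assume E: "E \<in> sets borel" and e: "0 < e"
    from eps[OF this] obtain K U
      where KU: "compact K" "K \<subseteq> E" "open U" "E \<subseteq> U" "measure m (U - K) < e"
      by metis
    then have "total_variation (of_measure m) (U - K) < ennreal e"
      using tv[of "U - K"] e by (auto intro: le_less_trans simp: ennreal_less_iff)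
    with KU show "\<exists>K U. compact K \<and> K \<subseteq> E \<and> open U \<and> E \<subseteq> U \<and>
        total_variation (of_measure m) (U - K) < ennreal e"
      by blast
  qed
  with c show ?thesis by (simp add: mem_carrier_measure_algebra)
qed

section \<open>Convolution with a point mass\<close>

lemma point_mass_eq_of_measure: "point_mass x = of_measure (return borel x)"
proof
  show "point_mass x E = of_measure (return borel x) E" for E
    by (cases "E \<in> sets borel")
      (auto simp: point_mass_def of_measure_def measure_return measure_notin_sets indicator_def)
qed

lemma open_left_translate:
  fixes U :: "'a::topological_group_add set"
  assumes "open U"
  shows "open {y. g + y \<in> U}"
proof -
  have "open ((\<lambda>y. g + y) -` U)"
    using assms by (intro continuous_open_vimage continuous_intros) auto
  then show ?thesis by (simp add: vimage_def)
qed

lemma left_translate_borel: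
  fixes E :: "'a::topological_group_add set"
  assumes "E \<in> sets borel"
  shows "{y. g + y \<in> E} \<in> sets borel"
proof -
  have "(\<lambda>y. g + y) \<in> borel_measurable borel"
    by (intro borel_measurable_continuous_onI continuous_intros)
  from measurable_sets[OF this assms] show ?thesis by (simp add: vimage_def)
qed

text \<open>
  For \<open>E\<close> open, \<open>g \<mapsto> m (- g + E)\<close> is lower semicontinuous: a compact subset \<open>K\<close> of \<open>- g + E\<close> of
  almost full measure satisfies \<open>K \<subseteq> - h + E\<close> for all \<open>h\<close> close to \<open>g\<close>, by the tube lemma.
  Dynkin's theorem on intersection-stable generators passes from open sets to Borel sets.
\<close>

lemma borel_measurable_measure_left_translate:
  fixes m :: "'a::{topological_group_add, t2_space} measure"
  assumes m: "finite_measure m" and sets: "sets m = sets borel"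
    and inner: "\<And>U e. open U \<Longrightarrow> 0 < e \<Longrightarrow> \<exists>K. compact K \<and> K \<subseteq> U \<and> measure m U < measure m K + e"
    and E: "E \<in> sets borel"
  shows "(\<lambda>g. measure m {y. g + y \<in> E}) \<in> borel_measurable borel"
proof -
  interpret finite_measure m by fact
  have space: "space m = UNIV" using sets_eq_imp_space_eq[OF sets] by simp
  have tr: "{y. g + y \<in> A} \<in> sets m" if "A \<in> sets borel" for g and A :: "'a set"
    using left_translate_borel[OF that] sets by simp
  have "Int_stable {S :: 'a set. open S}" by (auto simp: Int_stable_def)
  moreover have "{S :: 'a set. open S} \<subseteq> Pow UNIV" by simp
  moreover have "E \<in> sigma_sets UNIV {S. open S}" using E by (simp add: borel_def)
  ultimately show ?thesis
  proof (induction E rule: sigma_sets_induct_disjoint)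
    case (basic U)
    then have U: "open U" by simp
    show ?case
      unfolding borel_measurable_iff_greater
    proof (intro allI)
      fix c :: real
      have "open {g. c < measure m {y. g + y \<in> U}}"
      proof (subst open_subopen, intro ballI)
        fix g assume "g \<in> {g. c < measure m {y. g + y \<in> U}}"
        then have g: "0 < measure m {y. g + y \<in> U} - c" by simp
        have "open {y. g + y \<in> U}" using U by (rule open_left_translate)
        from inner[OF this g] obtain K
          where K: "compact K" "K \<subseteq> {y. g + y \<in> U}" "c < measure m K" by auto
        let ?W = "(\<lambda>p. fst p + snd p) -` U"
        have "open ?W"
          using U by (intro continuous_open_vimage continuous_intros) auto
        moreover have "{g} \<times> K \<subseteq> ?W" using K(2) by auto
        ultimately have "\<exists>V. g \<in> V \<and> open V \<and> V \<times> K \<subseteq> ?W"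
          by (rule Elementary_Topology.tube_lemma[OF K(1)])
        then obtain V where V: "g \<in> V" "open V" "V \<times> K \<subseteq> ?W"
          by (elim exE conjE)
        have "c < measure m {y. h + y \<in> U}" if "h \<in> V" for h
        proof -
          have "K \<subseteq> {y. h + y \<in> U}" using that V(3) by auto
          then have "measure m K \<le> measure m {y. h + y \<in> U}"
            using U by (intro finite_measure_mono tr) auto
          with K(3) show ?thesis by simp
        qed
        with V show "\<exists>T. open T \<and> g \<in> T \<and> T \<subseteq> {g. c < measure m {y. g + y \<in> U}}"
          by (intro exI[of _ V]) auto
      qed
      then show "{w \<in> space borel. c < measure m {y. w + y \<in> U}} \<in> sets borel"
        by simp
    qed
  next
    case empty
    then show ?case by simp
  next
    case (compl A)
    then have A: "A \<in> sets borel" by (simp add: borel_def)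
    have "measure m {y. g + y \<in> UNIV - A} = measure m UNIV - measure m {y. g + y \<in> A}" for g
      using finite_measure_compl[OF tr[OF A], of g] by (simp add: space set_diff_eq)
    with compl show ?case by simp
  next
    case (union A)
    then have A: "A i \<in> sets borel" for i by (auto simp: borel_def)
    have "(\<lambda>i. measure m {y. g + y \<in> A i}) sums measure m {y. g + y \<in> (\<Union>i. A i)}" for g
    proof -
      have "(\<lambda>i. measure m {y. g + y \<in> A i}) sums measure m (\<Union>i. {y. g + y \<in> A i})"
        using union(1) tr[OF A] unfolding disjoint_family_on_def
        by (intro finite_measure_UNION) (auto simp: disjoint_family_on_def)
      moreover have "(\<Union>i. {y. g + y \<in> A i}) = {y. g + y \<in> (\<Union>i. A i)}" by auto
      ultimately show ?thesis by simp
    qed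
    then have "measure m {y. g + y \<in> (\<Union>i. A i)} = (\<Sum>i. measure m {y. g + y \<in> A i})" for g
      by (rule sums_unique)
    with union(3) show ?case by (simp only: borel_measurable_suminf)
  qed
qed

lemma borel_measurable_left_translate:
  fixes \<mu> :: "'a::{topological_group_add, t2_space} set \<Rightarrow> complex"
  assumes "\<mu> \<in> carrier measure_algebra" and E: "E \<in> sets borel"
  shows "(\<lambda>g. \<mu> {y. g + y \<in> E}) \<in> borel_measurable borel"
proof -
  have pos: "(\<lambda>g. measure (positive_part (\<lambda>E. Re (\<mu> E))) {y. g + y \<in> E}) \<in> borel_measurable borel"
    if "\<mu> \<in> carrier measure_algebra" for \<mu> :: "'a set \<Rightarrow> complex"
  proof (rule borel_measurable_measure_left_translate)
    have \<mu>: "complex_borel_measure \<mu>" "regular_measure \<mu>"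
      using that by (auto simp: mem_carrier_measure_algebra)
    let ?P = "positive_part (\<lambda>E. Re (\<mu> E))"
    show "finite_measure ?P" by (rule finite_measure_positive_part[OF \<mu>(1)])
    then interpret finite_measure ?P .
    fix U :: "'a set" and e :: real assume U: "open U" and e: "0 < e"
    then obtain K V where KV: "compact K" "K \<subseteq> U" "open V" "U \<subseteq> V" "total_variation \<mu> (V - K) < ennreal e"
      using \<mu>(2)[unfolded regular_measure_iff[OF \<mu>(1)], rule_format, of U e] by auto
    have b: "K \<in> sets borel" "U \<in> sets borel" "V \<in> sets borel"
      using KV U by (simp_all add: borel_compact)
    have "emeasure ?P (U - K) \<le> total_variation \<mu> (V - K)"
    proof -
      have "ennreal (Re (\<mu> A)) \<le> total_variation \<mu> (V - K)" if "A \<in> sets borel" "A \<subseteq> U - K" for A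
      proof -
        have "ennreal (Re (\<mu> A)) \<le> ennreal (cmod (\<mu> A))"
          by (intro ennreal_leI complex_Re_le_cmod)
        also have "\<dots> \<le> total_variation \<mu> (V - K)"
          by (rule cmod_le_total_variation[OF \<mu>(1)]) (use that b KV(4) in auto)
        finally show ?thesis .
      qed
      moreover have "U - K \<in> sets borel" using b by simp
      ultimately show ?thesis
        by (subst emeasure_positive_part[OF \<mu>(1)]) (auto intro!: SUP_least)
    qed
    from le_less_trans[OF this KV(5)] have "measure ?P (U - K) < e"
      unfolding emeasure_eq_measure by (simp add: ennreal_less_iff)
    moreover have "measure ?P (U - K) = measure ?P U - measure ?P K"
      using b KV(2) by (intro finite_measure_Diff) auto
    ultimately show "\<exists>K. compact K \<and> K \<subseteq> U \<and> measure ?P U < measure ?P K + e"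
      using KV(1,2) by (intro exI[of _ K]) auto
  qed (use E in simp_all)
  have Re: "(\<lambda>g. Re (\<mu> {y. g + y \<in> E})) \<in> borel_measurable borel"
    if \<mu>: "\<mu> \<in> carrier measure_algebra" for \<mu> :: "'a set \<Rightarrow> complex"
  proof -
    have c: "complex_borel_measure \<mu>" using \<mu> by (simp add: mem_carrier_measure_algebra)
    have "(\<lambda>g. measure (positive_part (\<lambda>E. Re (\<mu> E))) {y. g + y \<in> E} -
        measure (positive_part (\<lambda>E. Re (-1 * \<mu> E))) {y. g + y \<in> E}) \<in> borel_measurable borel"
      by (intro borel_measurable_diff pos carrier_measure_algebra_scale \<mu>)
    moreover have "measure (positive_part (\<lambda>E. Re (\<mu> E))) {y. g + y \<in> E} -
        measure (positive_part (\<lambda>E. Re (-1 * \<mu> E))) {y. g + y \<in> E} = Re (\<mu> {y. g + y \<in> E})" for g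
      using jordan_decomposition[OF c left_translate_borel[OF E]] by simp
    ultimately show ?thesis by simp
  qed
  have "(\<lambda>g. Im (\<mu> {y. g + y \<in> E})) \<in> borel_measurable borel"
    using Re[OF carrier_measure_algebra_scale[OF assms(1), of "-\<i>"]] by simp
  with Re[OF assms(1)] show ?thesis
    by (simp add: borel_measurable_complex_iff)
qed

lemma integral_positive_part_zero:
  assumes "\<And>A. A \<in> sets borel \<Longrightarrow> \<nu> A \<le> 0"
  shows "integral\<^sup>L (positive_part \<nu>) f = (0::complex)"
proof -
  have "(\<lambda>E. SUP A \<in> {A \<in> sets borel. A \<subseteq> E}. ennreal (\<nu> A)) = (\<lambda>E. 0)"
    using assms by (auto simp: fun_eq_iff ennreal_neg intro!: antisym SUP_least)
  then have "positive_part \<nu> = measure_of UNIV (sets borel) (\<lambda>E. 0)"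
    by (simp add: positive_part_def)
  then have "emeasure (positive_part \<nu>) UNIV = 0"
    by (simp add: emeasure_sigma)
  then have "AE x in positive_part \<nu>. f x = 0"
    by (intro AE_I[where N=UNIV]) auto
  then show ?thesis
    by (rule integral_eq_zero_AE)
qed

lemma convolution_zero_left: "convolution (\<lambda>E. 0) \<nu> = (\<lambda>E. 0)"
  by (simp add: convolution_def fun_eq_iff integral_complex_measure_def integral_positive_part_zero)

lemma convolution_point_mass_zero_left:
  fixes \<nu> :: "'a::{topological_group_add, t2_space} set \<Rightarrow> complex"
  assumes \<nu>: "\<nu> \<in> carrier measure_algebra"
  shows "convolution (point_mass 0) \<nu> = \<nu>"
proof
  fix E :: "'a set"
  have P: "positive_part (\<lambda>E. Re (point_mass (0::'a) E)) = return borel 0"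
  proof (rule measure_eqI)
    fix A :: "'a set" assume "A \<in> sets (positive_part (\<lambda>E. Re (point_mass 0 E)))"
    then have A: "A \<in> sets borel" by simp
    have "(SUP B \<in> {B \<in> sets borel. B \<subseteq> A}. ennreal (Re (point_mass 0 B))) = indicator A 0"
    proof (rule antisym)
      show "(SUP B \<in> {B \<in> sets borel. B \<subseteq> A}. ennreal (Re (point_mass 0 B))) \<le> indicator A 0"
      proof (rule SUP_least, clarify)
        fix B assume "B \<subseteq> A"
        then show "ennreal (Re (point_mass 0 B)) \<le> indicator A 0"
          by (auto simp: point_mass_def indicator_def)
      qed
      show "indicator A 0 \<le> (SUP B \<in> {B \<in> sets borel. B \<subseteq> A}. ennreal (Re (point_mass 0 B)))"
        using A by (intro SUP_upper2[of A]) (auto simp: point_mass_def indicator_def)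
    qed
    moreover have "complex_borel_measure (point_mass (0::'a))"
      unfolding complex_borel_measure_def
    proof (intro conjI allI impI)
      fix F :: "nat \<Rightarrow> 'a set" assume "range F \<subseteq> sets borel" "disjoint_family F"
      then have "(\<lambda>n. measure (return borel 0) (F n)) sums measure (return borel (0::'a)) (\<Union>n. F n)"
        by (intro finite_measure.finite_measure_UNION prob_space.finite_measure prob_space_return) auto
      then show "(\<lambda>n. point_mass 0 (F n)) sums point_mass (0::'a) (\<Union>n. F n)"
        unfolding point_mass_eq_of_measure of_measure_def by (rule sums_of_real)
    qed (simp add: point_mass_def)
    ultimately show "emeasure (positive_part (\<lambda>E. Re (point_mass 0 E))) A = emeasure (return borel 0) A"
      using A by (simp add: emeasure_positive_part)
  qed simp
  have z: "integral\<^sup>L (positive_part (\<lambda>E. - Re (point_mass (0::'a) E))) f = 0"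
      "integral\<^sup>L (positive_part (\<lambda>E. Im (point_mass (0::'a) E))) f = 0"
      "integral\<^sup>L (positive_part (\<lambda>E. - Im (point_mass (0::'a) E))) f = 0" for f :: "'a \<Rightarrow> complex"
    by (auto intro!: integral_positive_part_zero simp: point_mass_def)
  show "convolution (point_mass 0) \<nu> E = \<nu> E"
  proof (cases "E \<in> sets borel")
    case True
    have "integral\<^sup>L (return borel 0) (\<lambda>x. \<nu> {y. x + y \<in> E}) = \<nu> E"
      by (subst integral_return) (auto intro: borel_measurable_left_translate[OF \<nu> True])
    with True show ?thesis
      by (simp add: convolution_def integral_complex_measure_def z P)
  next
    case False
    with \<nu> show ?thesis
      by (simp add: convolution_def mem_carrier_measure_algebra complex_borel_measure_def)
  qed
qed

section \<open>Finite sums in the measure algebra\<close>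

lemma zero_in_carrier_measure_algebra:
  "(\<lambda>E. 0) \<in> carrier (measure_algebra :: ('a::{topological_group_add, t2_space} set \<Rightarrow> complex) ring)"
proof -
  have c: "complex_borel_measure (\<lambda>E :: 'a set. 0)"
    by (simp add: complex_borel_measure_def)
  have "total_variation (\<lambda>E :: 'a set. 0) E \<le> 0" for E
    by (rule total_variation_leI) simp
  then have "regular_measure (\<lambda>E :: 'a set. 0)"
    unfolding regular_measure_iff[OF c] by (intro ballI allI impI exI[of _ "{}"] exI[of _ UNIV]) simp
  with c show ?thesis by (simp add: mem_carrier_measure_algebra)
qed

lemma finsum_measure_algebra_eq:
  "finsum measure_algebra v A =
    (if finite A then THE s. (A, s) \<in> foldSetD (carrier measure_algebra) (\<lambda>i \<mu> E. v i E + \<mu> E) (\<lambda>E. 0)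
     else (\<lambda>E. 0))"
  by (simp add: finsum_def finprod_def foldD_def measure_algebra_def comp_def)

lemma foldSetD_pointwise_sum:
  assumes "(A, s) \<in> foldSetD D (\<lambda>i \<mu> E. v i E + \<mu> E) (\<lambda>E. 0)"
  shows "s = (\<lambda>E. \<Sum>i\<in>A. v i E :: complex)"
  using assms
proof induction
  case (insertI i A \<mu>)
  then have "finite A" by (auto dest: foldSetD_imp_finite)
  with insertI show ?case by simp
qed simp

lemma finsum_measure_algebra:
  fixes v :: "'i \<Rightarrow> 'a::{topological_group_add, t2_space} set \<Rightarrow> complex"
  assumes "finite A" "\<And>i. i \<in> A \<Longrightarrow> v i \<in> carrier measure_algebra"
  shows "finsum measure_algebra v A = (\<lambda>E. \<Sum>i\<in>A. v i E)"
proof -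
  let ?fold = "foldSetD (carrier measure_algebra) (\<lambda>i \<mu> E. v i E + \<mu> E) (\<lambda>E. 0)"
  note zero = zero_in_carrier_measure_algebra
  have "\<exists>s. (A, s) \<in> ?fold"
    using assms
  proof (induction A rule: finite_induct)
    case (insert i A)
    then obtain s where s: "(A, s) \<in> ?fold" by auto
    have "(\<lambda>E. v i E + s E) \<in> carrier measure_algebra"
      using insert foldSetD_closed[OF s] by (intro carrier_measure_algebra_add) auto
    with s insert show ?case
      by (intro exI[of _ "\<lambda>E. v i E + s E"] foldSetD.insertI) auto
  next
    case empty
    show ?case by (rule exI, rule foldSetD.emptyI, rule zero)
  qed
  then obtain s where s: "(A, s) \<in> ?fold" by blast
  then have "(THE s. (A, s) \<in> ?fold) = (\<lambda>E. \<Sum>i\<in>A. v i E)"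
    by (intro the_equality) (use foldSetD_pointwise_sum in \<open>blast+\<close>)
  with assms(1) show ?thesis
    by (simp add: finsum_measure_algebra_eq)
qed

text \<open>
  If some partial sum leaves the algebra, the sum has no value in the recursive definition of
  finite sums, and \<^const>\<open>finsum\<close> returns a fixed element that does not depend on the summands.
\<close>

lemma finsum_measure_algebra_cases:
  assumes "finite A"
  shows "finsum measure_algebra v A = (\<lambda>E. \<Sum>i\<in>A. v i E) \<or> finsum measure_algebra v A = (THE s. False)"
proof (cases "\<exists>s. (A, s) \<in> foldSetD (carrier measure_algebra) (\<lambda>i \<mu> E. v i E + \<mu> E) (\<lambda>E. 0)")
  case True
  then obtain s where s: "(A, s) \<in> foldSetD (carrier measure_algebra) (\<lambda>i \<mu> E. v i E + \<mu> E) (\<lambda>E. 0)"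
    by blast
  then have "(THE s. (A, s) \<in> foldSetD (carrier measure_algebra) (\<lambda>i \<mu> E. v i E + \<mu> E) (\<lambda>E. 0))
      = (\<lambda>E. \<Sum>i\<in>A. v i E)"
    by (intro the_equality) (use foldSetD_pointwise_sum in \<open>blast+\<close>)
  with assms show ?thesis by (simp add: finsum_measure_algebra_eq)
next
  case False
  with assms show ?thesis by (simp add: finsum_measure_algebra_eq)
qed

section \<open>Finite generation implies compactness\<close>

text \<open>
  A function that is not integrable has integral \<open>0\<close>, so only the integrable \<open>h k\<close> contribute.
\<close>

lemma sum_norm_integral_le:
  fixes h :: "nat \<Rightarrow> 'a \<Rightarrow> complex"
  assumes M: "finite_measure M" and h: "\<And>x. (\<Sum>k<N. cmod (h k x)) \<le> D"
  shows "(\<Sum>k<N. cmod (integral\<^sup>L M (h k))) \<le> D * measure M (space M)"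
proof -
  interpret finite_measure M by fact
  define J where "J = {k\<in>{..<N}. integrable M (h k)}"
  have "(\<Sum>k<N. cmod (integral\<^sup>L M (h k))) = (\<Sum>k\<in>J. cmod (integral\<^sup>L M (h k)))"
    by (intro sum.mono_neutral_right) (auto simp: J_def not_integrable_integral_eq)
  also have "\<dots> \<le> (\<Sum>k\<in>J. integral\<^sup>L M (\<lambda>x. cmod (h k x)))"
    by (intro sum_mono integral_norm_bound)
  also have "\<dots> = integral\<^sup>L M (\<lambda>x. \<Sum>k\<in>J. cmod (h k x))"
    by (intro Bochner_Integration.integral_sum[symmetric] integrable_norm) (auto simp: J_def)
  also have "\<dots> \<le> integral\<^sup>L M (\<lambda>x. D)"
  proof (rule integral_mono)
    show "integrable M (\<lambda>x. \<Sum>k\<in>J. cmod (h k x))"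
      by (intro Bochner_Integration.integrable_sum integrable_norm) (auto simp: J_def)
    show "(\<Sum>k\<in>J. cmod (h k x)) \<le> D" for x
      by (rule order_trans[OF sum_mono2 h]) (auto simp: J_def)
  qed simp
  finally show ?thesis by (simp add: mult.commute)
qed

text \<open>
  The factor \<open>4\<close> counts the positive and negative parts of the real and imaginary part.
\<close>

lemma sum_norm_integral_complex_measure_le:
  fixes h :: "nat \<Rightarrow> 'a::topological_space \<Rightarrow> complex"
  assumes \<mu>: "complex_borel_measure \<mu>" and C: "\<And>E. cmod (\<mu> E) \<le> C"
    and h: "\<And>x. (\<Sum>k<N. cmod (h k x)) \<le> D"
  shows "(\<Sum>k<N. cmod (integral_complex_measure \<mu> (h k))) \<le> 4 * (D * C)"
proof -
  have D: "0 \<le> D" by (rule order_trans[OF sum_nonneg h]) simp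
  have part: "(\<Sum>k<N. cmod (integral\<^sup>L (positive_part (\<lambda>E. Re (c * \<mu> E))) (h k))) \<le> D * C"
    if "cmod c = 1" for c
  proof -
    have c: "complex_borel_measure (\<lambda>E. c * \<mu> E)" by (rule complex_borel_measure_scale[OF \<mu>])
    let ?P = "positive_part (\<lambda>E. Re (c * \<mu> E))"
    interpret finite_measure ?P by (rule finite_measure_positive_part[OF c])
    have "0 \<le> C" using C[of "{}"] by (rule order_trans[OF norm_ge_zero])
    moreover have "emeasure ?P UNIV \<le> ennreal C"
      using C that by (intro emeasure_positive_part_le[OF c]) (simp add: norm_mult)
    ultimately have "measure ?P (space ?P) \<le> C"
      unfolding emeasure_eq_measure space_positive_part by (simp only: ennreal_le_iff)
    then have "D * measure ?P (space ?P) \<le> D * C"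
      using D by (rule mult_left_mono)
    with sum_norm_integral_le[OF finite_measure_axioms h] show ?thesis
      by (rule order_trans)
  qed
  have "cmod (integral_complex_measure \<mu> f)
      \<le> cmod (integral\<^sup>L (positive_part (\<lambda>E. Re (1 * \<mu> E))) f)
        + cmod (integral\<^sup>L (positive_part (\<lambda>E. Re (-1 * \<mu> E))) f)
        + cmod (integral\<^sup>L (positive_part (\<lambda>E. Re (-\<i> * \<mu> E))) f)
        + cmod (integral\<^sup>L (positive_part (\<lambda>E. Re (\<i> * \<mu> E))) f)" for f
  proof -
    have tri: "cmod ((a - b) + \<i> * (c - d)) \<le> cmod a + cmod b + cmod c + cmod d" for a b c d
      using norm_triangle_ineq[of "a - b" "\<i> * (c - d)"] norm_triangle_ineq4[of a b]
        norm_triangle_ineq4[of c d] by (simp add: norm_mult)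
    show ?thesis
      unfolding integral_complex_measure_def by (rule order_trans[OF tri]) simp
  qed
  then have "(\<Sum>k<N. cmod (integral_complex_measure \<mu> (h k))) \<le> (\<Sum>k<N.
        cmod (integral\<^sup>L (positive_part (\<lambda>E. Re (1 * \<mu> E))) (h k))
        + cmod (integral\<^sup>L (positive_part (\<lambda>E. Re (-1 * \<mu> E))) (h k))
        + cmod (integral\<^sup>L (positive_part (\<lambda>E. Re (-\<i> * \<mu> E))) (h k))
        + cmod (integral\<^sup>L (positive_part (\<lambda>E. Re (\<i> * \<mu> E))) (h k)))"
    by (intro sum_mono)
  also have "\<dots> \<le> D * C + D * C + D * C + D * C"
    unfolding sum.distrib by (intro add_mono part) simp_all
  finally show ?thesis by (simp add: mult.commute)
qed

text \<open>
  Regularity at the whole space gives a compact set \<open>K\<close> whose complement has small variation. A set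
  that contains \<open>K\<close> has the opposite measure of its complement, because the total mass is \<open>0\<close>.
\<close>

lemma augmentation_ideal_tight:
  fixes \<mu> :: "'a::{topological_group_add, t2_space} set \<Rightarrow> complex"
  assumes \<mu>: "\<mu> \<in> augmentation_ideal" and e: "0 < e"
  shows "\<exists>K. compact K \<and> (\<forall>S\<in>sets borel. S \<inter> K = {} \<or> K \<subseteq> S \<longrightarrow> cmod (\<mu> S) \<le> e)"
proof -
  have c: "complex_borel_measure \<mu>" "regular_measure \<mu>" and zero: "\<mu> UNIV = 0"
    using \<mu> by (auto simp: augmentation_ideal_def mem_carrier_measure_algebra)
  obtain K U where KU: "compact K" "open U" "UNIV \<subseteq> U" "total_variation \<mu> (U - K) < ennreal e"
    using c(2)[unfolded regular_measure_iff[OF c(1)], rule_format, of UNIV e] e by auto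
  have K: "K \<in> sets borel" using KU(1) by (rule borel_compact)
  have small: "cmod (\<mu> S) \<le> e" if S: "S \<in> sets borel" "S \<inter> K = {}" for S
  proof -
    have "ennreal (cmod (\<mu> S)) \<le> total_variation \<mu> (U - K)"
      using S KU K by (intro cmod_le_total_variation[OF c(1)]) auto
    from le_less_trans[OF this KU(4)] e show ?thesis
      by (simp add: ennreal_less_iff)
  qed
  have "cmod (\<mu> S) \<le> e" if S: "S \<in> sets borel" "K \<subseteq> S" for S
  proof -
    have "\<mu> (UNIV - S) = \<mu> UNIV - \<mu> S"
      using S by (intro complex_borel_measure_Diff[OF c(1)]) auto
    then have "cmod (\<mu> S) = cmod (\<mu> (UNIV - S))" using zero by simp
    also have "\<dots> \<le> e" using S by (intro small) auto
    finally show ?thesis .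
  qed
  with small KU(1) show ?thesis by blast
qed

text \<open>
  Let \<open>K\<^sub>k\<close> be compact such that each of the given measures has modulus at most \<open>2\<^sup>-\<^sup>k\<close> on Borel sets
  that miss or contain \<open>K\<^sub>k\<close>, and put \<open>C\<^sub>k\<^sub>+\<^sub>1 = C\<^sub>k \<union> (C\<^sub>k + K\<^sub>k\<^sub>+\<^sub>1) \<union> (C\<^sub>k - K\<^sub>k\<^sub>+\<^sub>1)\<close>. A translate
  \<open>- g + C\<^sub>k\<^sub>+\<^sub>1\<close> contains \<open>K\<^sub>k\<^sub>+\<^sub>1\<close> if \<open>g \<in> C\<^sub>k\<close>, and misses \<open>K\<^sub>k\<^sub>+\<^sub>2\<close> if \<open>g \<notin> C\<^sub>k\<^sub>+\<^sub>2\<close>. In both cases its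
  measure has modulus at most \<open>2\<^sup>-\<^sup>k\<close>, and at most two indices \<open>k\<close> remain for each \<open>g\<close>.
\<close>

lemma slowly_varying_exhaustion:
  fixes F :: "('a::{topological_group_add, t2_space} set \<Rightarrow> complex) set"
  assumes "finite F" and F: "F \<subseteq> augmentation_ideal"
  shows "\<exists>B :: nat \<Rightarrow> 'a set. (\<forall>k. compact (B k) \<and> 0 \<in> B k) \<and>
    (\<forall>\<mu>\<in>F. \<exists>D. \<forall>g N. (\<Sum>k<N. cmod (\<mu> {y. g + y \<in> B k})) \<le> D)"
proof -
  have "\<forall>\<mu>\<in>F. \<forall>k::nat. \<exists>K. compact K \<and>
      (\<forall>S\<in>sets borel. S \<inter> K = {} \<or> K \<subseteq> S \<longrightarrow> cmod (\<mu> S) \<le> (1/2)^k)"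
    using F augmentation_ideal_tight by (metis subsetD zero_less_power half_gt_zero_iff zero_less_one)
  then obtain L where L: "\<And>\<mu> k. \<mu> \<in> F \<Longrightarrow> compact (L \<mu> k)"
      "\<And>\<mu> k S. \<mu> \<in> F \<Longrightarrow> S \<in> sets borel \<Longrightarrow> S \<inter> L \<mu> k = {} \<or> L \<mu> k \<subseteq> S \<Longrightarrow> cmod (\<mu> S) \<le> (1/2)^k"
    by metis
  define K where "K k = (\<Union>\<mu>\<in>F. L \<mu> k)" for k
  have K: "compact (K k)" for k
    unfolding K_def using L(1) \<open>finite F\<close> by (intro compact_UN) auto
  have small: "cmod (\<mu> S) \<le> (1/2)^k" if "\<mu> \<in> F" "S \<in> sets borel" "S \<inter> K k = {} \<or> K k \<subseteq> S" for \<mu> k S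
    using that(3) by (intro L(2) that(1,2)) (use that(1) in \<open>auto simp: K_def\<close>)
  define step where "step k B = B \<union> (\<lambda>p. fst p + snd p) ` (B \<times> K k) \<union> (\<lambda>p. fst p - snd p) ` (B \<times> K k)"
    for k and B :: "'a set"
  define C where "C = rec_nat {0} (\<lambda>k. step (Suc k))"
  have C0: "C 0 = {0}" and CS: "C (Suc k) = step (Suc k) (C k)" for k
    by (simp_all add: C_def)
  have compact_C: "compact (C k)" for k
  proof (induction k)
    case (Suc k)
    show ?case
      unfolding CS step_def
      by (intro compact_Un Suc compact_continuous_image compact_Times K continuous_intros)
  qed (simp add: C0)
  have sub: "C k \<subseteq> C (Suc k)" for k by (auto simp: CS step_def)
  have zero: "0 \<in> C k" for k
    by (induction k) (use C0 sub in auto)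
  have plus: "g + y \<in> C (Suc k)" and minus: "g - y \<in> C (Suc k)" if "g \<in> C k" "y \<in> K (Suc k)" for g y k
    using that by (force simp: CS step_def)+
  have bor: "{y. g + y \<in> C k} \<in> sets borel" for g k
    by (intro left_translate_borel borel_compact compact_C)
  define b where "b g k = (if g \<in> C k then 1 else 0 :: real)" for g k
  have bound: "\<exists>D. \<forall>g N. (\<Sum>k<N. cmod (\<mu> {y. g + y \<in> C (Suc k)})) \<le> D" if \<mu>: "\<mu> \<in> F" for \<mu>
  proof -
    have "complex_borel_measure \<mu>"
      using \<mu> F by (auto simp: augmentation_ideal_def mem_carrier_measure_algebra)
    from complex_borel_measure_bounded[OF this] obtain X
      where X: "0 \<le> X" "\<And>E. cmod (\<mu> E) \<le> X" by metis
    have one: "cmod (\<mu> {y. g + y \<in> C (Suc k)}) \<le> (1/2)^k + X * (b g (Suc (Suc k)) - b g k)" for g k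
    proof -
      have half: "(1/2)^Suc k \<le> (1/2::real)^k" "(1/2)^Suc (Suc k) \<le> (1/2::real)^k" by simp_all
      have mono: "g \<in> C k \<Longrightarrow> g \<in> C (Suc (Suc k))" using sub by blast
      consider "g \<in> C k" | "g \<notin> C (Suc (Suc k))" | "g \<notin> C k" "g \<in> C (Suc (Suc k))" by blast
      then show ?thesis
      proof cases
        case 1
        then have "K (Suc k) \<subseteq> {y. g + y \<in> C (Suc k)}" using plus by blast
        then have "cmod (\<mu> {y. g + y \<in> C (Suc k)}) \<le> (1/2)^Suc k" by (intro small \<mu> bor) simp
        moreover have "X * (b g (Suc (Suc k)) - b g k) = 0" using 1 mono by (simp add: b_def)
        ultimately show ?thesis using half(1) by linarith
      next
        case 2
        have "{y. g + y \<in> C (Suc k)} \<inter> K (Suc (Suc k)) = {}"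
        proof -
          have "y \<notin> K (Suc (Suc k))" if "g + y \<in> C (Suc k)" for y
            using minus[OF that, of y] 2 by auto
          then show ?thesis by blast
        qed
        then have "cmod (\<mu> {y. g + y \<in> C (Suc k)}) \<le> (1/2)^Suc (Suc k)" by (intro small \<mu> bor) simp
        moreover have "X * (b g (Suc (Suc k)) - b g k) = 0" using 2 mono by (auto simp: b_def)
        ultimately show ?thesis using half(2) by linarith
      next
        case 3
        then have "X * (b g (Suc (Suc k)) - b g k) = X" by (simp add: b_def)
        moreover have "cmod (\<mu> {y. g + y \<in> C (Suc k)}) \<le> X" by (rule X(2))
        moreover have "0 \<le> (1/2::real)^k" by simp
        ultimately show ?thesis by linarith
      qed
    qed
    \<comment> \<open>The indices without a small bound are those where \<open>g\<close> enters between \<open>C k\<close> and \<open>C (k + 2)\<close>.\<close>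
    have tele: "(\<Sum>k<N. b g (Suc (Suc k)) - b g k) = b g (Suc N) + b g N - b g 1 - b g 0" for g N
      by (induction N) simp_all
    have geo: "(\<Sum>k<N. (1/2::real)^k) \<le> 2" for N
      by (simp add: sum_gp_strict)
    have "(\<Sum>k<N. cmod (\<mu> {y. g + y \<in> C (Suc k)})) \<le> 2 + X * 2" for g N
    proof -
      have "(\<Sum>k<N. cmod (\<mu> {y. g + y \<in> C (Suc k)}))
          \<le> (\<Sum>k<N. (1/2)^k) + X * (\<Sum>k<N. b g (Suc (Suc k)) - b g k)"
        unfolding sum_distrib_left sum.distrib[symmetric] by (intro sum_mono one)
      also have "\<dots> \<le> 2 + X * 2"
        unfolding tele using X(1) by (intro add_mono geo mult_left_mono) (auto simp: b_def)
      finally show ?thesis .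
    qed
    then show ?thesis by blast
  qed
  \<comment> \<open>The shift by one lets the bound for the index \<open>k\<close> refer to \<open>C k\<close> as the preceding set.\<close>
  show ?thesis
    by (rule exI[of _ "\<lambda>k. C (Suc k)"]) (intro conjI allI ballI compact_C zero bound)
qed

text \<open>
  All but a small part of the mass sits at finitely many points. Removing from the space those that
  lie outside \<open>E\<close>, and keeping those inside, gives the open and the compact set.
\<close>

lemma discrete_measure_in_carrier:
  fixes g :: "nat \<Rightarrow> 'a::{topological_group_add, t2_space}"
  shows "of_measure (distr (measure_pmf p) borel g) \<in> carrier measure_algebra"
proof (rule of_measure_in_carrier)
  let ?m = "distr (measure_pmf p) borel g"
  show "finite_measure ?m"
    by (intro measure_pmf.finite_measure_distr) simp
  fix E :: "'a set" and e :: real assume E: "E \<in> sets borel" and e: "0 < e"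
  have "(\<lambda>n. measure p {n..}) \<longlonglongrightarrow> measure p (\<Inter>n. {n..})"
    by (intro measure_pmf.finite_Lim_measure_decseq) (auto simp: decseq_def)
  moreover have "(\<Inter>n::nat. {n..}) = {}" using Suc_n_not_le_n by blast
  ultimately have "(\<lambda>n. measure p {n..}) \<longlonglongrightarrow> 0" by simp
  then have "eventually (\<lambda>n. measure p {n..} < e) sequentially"
    using e by (rule order_tendstoD(2))
  then obtain n where n: "measure p {n..} < e"
    by (auto simp: eventually_sequentially)
  define K where "K = g ` {k. k < n \<and> g k \<in> E}"
  define U where "U = - g ` {k. k < n \<and> g k \<notin> E}"
  have K: "finite K" "K \<subseteq> E" by (auto simp: K_def)
  have U: "open U" "E \<subseteq> U"
    unfolding U_def by (auto intro!: open_Compl finite_imp_closed)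
  have "measure ?m (U - K) = measure p (g -` (U - K))"
    using U(1) K(1) by (subst measure_distr) (auto simp: finite_imp_closed)
  also have "\<dots> \<le> measure p {n..}"
    by (intro measure_pmf.finite_measure_mono) (auto simp: U_def K_def not_less[symmetric])
  also have "\<dots> < e" by (rule n)
  finally show "\<exists>K U. compact K \<and> K \<subseteq> E \<and> open U \<and> E \<subseteq> U \<and> measure ?m (U - K) < e"
    using K U finite_imp_compact by metis
qed simp

lemma point_mass_in_carrier:
  "point_mass (x :: 'a::{topological_group_add, t2_space}) \<in> carrier measure_algebra"
proof -
  have "distr (measure_pmf (return_pmf (0::nat))) borel (\<lambda>_. x) = return borel x"
    by (simp add: return_pmf.rep_eq distr_return)
  then show ?thesis
    using discrete_measure_in_carrier[of "return_pmf 0" "\<lambda>_. x"] by (simp add: point_mass_eq_of_measure)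
qed

text \<open>
  The mass \<open>2\<^sup>-\<^sup>k\<^sup>-\<^sup>1\<close> is put at a point outside the first \<open>4\<^sup>k\<close> of the sets, so that it contributes
  \<open>4\<^sup>k \<cdot> 2\<^sup>-\<^sup>k\<^sup>-\<^sup>1\<close> to the sum.
\<close>

lemma not_summable_on_exhaustion:
  fixes B :: "nat \<Rightarrow> 'a::{topological_group_add, t2_space} set"
  assumes noncompact: "\<not> compact (UNIV :: 'a set)" and B: "\<And>k. compact (B k)" "\<And>k. 0 \<in> B k"
  shows "\<exists>f\<in>augmentation_ideal. \<forall>D. \<exists>N. D < (\<Sum>k<N. cmod (f (B k)))"
proof -
  have "\<exists>g. \<forall>j<4^k. g \<notin> B j" for k :: nat
  proof (rule ccontr)
    assume "\<not> (\<exists>g. \<forall>j<4^k. g \<notin> B j)"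
    then have "(\<Union>j<4^k. B j) = UNIV" by blast
    moreover have "compact (\<Union>j<4^k. B j)" using B(1) by (intro compact_UN) auto
    ultimately show False using noncompact by simp
  qed
  then obtain g where g: "\<And>k j. j < 4^k \<Longrightarrow> g k \<notin> B j" by metis
  define p where "p = geometric_pmf (1/2)"
  define m where "m = distr (measure_pmf p) borel g"
  define f where "f = (\<lambda>E. of_measure m E + (-1) * point_mass 0 E)"
  have m: "prob_space m" unfolding m_def by (intro measure_pmf.prob_space_distr) simp
  interpret m: prob_space m by fact
  have [simp]: "sets m = sets borel" "space m = UNIV" by (simp_all add: m_def)
  have bor: "B k \<in> sets borel" for k using B(1) by (rule borel_compact)
  have "f \<in> carrier measure_algebra"
    unfolding f_def m_def
    by (intro carrier_measure_algebra_add carrier_measure_algebra_scale discrete_measure_in_carrier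
        point_mass_in_carrier)
  moreover have "f UNIV = 0"
    using m.prob_space by (simp add: f_def of_measure_def point_mass_def)
  ultimately have f: "f \<in> augmentation_ideal" by (simp add: augmentation_ideal_def)
  have "\<exists>N. D < (\<Sum>k<N. cmod (f (B k)))" for D
  proof -
    have large: "(1/2)^Suc k \<le> cmod (f (B j))" if "j < 4^k" for k j
    proof -
      have "(1/2)^Suc k = measure p {k}"
        by (simp add: p_def measure_pmf_single)
      also have "\<dots> \<le> measure p (g -` (- B j))"
        using g[OF that] by (intro measure_pmf.finite_measure_mono) auto
      also have "\<dots> = measure m (UNIV - B j)"
        unfolding m_def using bor by (subst measure_distr) (auto simp: Compl_eq_Diff_UNIV)
      also have "\<dots> = 1 - measure m (B j)"
        using m.prob_compl[of "B j"] bor by simp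
      also have "\<dots> \<le> cmod (of_real (measure m (B j) - 1))"
        unfolding norm_of_real by linarith
      also have "of_real (measure m (B j) - 1) = f (B j)"
        using bor B(2) by (simp add: f_def of_measure_def point_mass_def)
      finally show ?thesis .
    qed
    obtain k :: nat where k: "2 * D < 2 ^ k"
      using real_arch_pow[of 2 "2 * D"] by auto
    have "2 * D < 2 ^ k" by (rule k)
    also have "(2::real) ^ k = 2 * (4 ^ k * (1/2) ^ Suc k)"
      by (simp add: power_mult_distrib[symmetric] flip: power_mult)
    also have "4 ^ k * (1/2::real) ^ Suc k = (\<Sum>j<(4::nat)^k. (1/2) ^ Suc k)"
      by simp
    also have "\<dots> \<le> (\<Sum>j<4^k. cmod (f (B j)))"
      by (intro sum_mono large) simp
    finally show ?thesis by (intro exI[of _ "4^k"]) simp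
  qed
  with f show ?thesis by blast
qed

text \<open>
  Every element \<open>\<Sum>\<^sub>i a\<^sub>i * x\<^sub>i\<close> takes absolutely summable values on the exhaustion belonging to the
  generators. A measure in the ideal whose values are not summable there, and its double, must
  then both be equal to the default value of finite sums.
\<close>

lemma compact_if_finitely_generated:
  assumes fg: "finitely_generated_left_ideal
    (measure_algebra :: ('a::{topological_group_add, t2_space} set \<Rightarrow> complex) ring) augmentation_ideal"
  shows "compact (UNIV :: 'a set)"
proof (rule ccontr)
  assume noncompact: "\<not> compact (UNIV :: 'a set)"
  let ?R = "measure_algebra :: ('a set \<Rightarrow> complex) ring"
  have mult: "mult ?R = convolution" by (simp add: measure_algebra_def)
  obtain n :: nat and x where x: "x \<in> {..<n} \<rightarrow> carrier ?R"
    and gen: "augmentation_ideal = {finsum ?R (\<lambda>i. convolution (a i) (x i)) {..<n} | a. a \<in> {..<n} \<rightarrow> carrier ?R}"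
    using fg unfolding finitely_generated_left_ideal_def mult by blast
  have x_aug: "x i \<in> augmentation_ideal" if i: "i < n" for i
  proof -
    \<comment> \<open>\<open>x i\<close> is the combination with coefficient \<open>\<delta>\<^sub>0\<close> at \<open>i\<close> and \<open>0\<close> elsewhere.\<close>
    define a where "a = (\<lambda>j. if j = i then point_mass 0 else (\<lambda>E :: 'a set. 0))"
    have conv: "convolution (a j) (x j) = (\<lambda>E. if j = i then x i E else 0)" if "j < n" for j
    proof (cases "j = i")
      case True
      have "x i \<in> carrier ?R" using x i by blast
      then show ?thesis using True by (simp add: a_def convolution_point_mass_zero_left)
    qed (simp add: a_def convolution_zero_left)
    have a: "a \<in> {..<n} \<rightarrow> carrier ?R"
      by (auto simp: a_def point_mass_in_carrier zero_in_carrier_measure_algebra)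
    have "convolution (a j) (x j) \<in> carrier ?R" if "j < n" for j
      using x i zero_in_carrier_measure_algebra unfolding conv[OF that] by (cases "j = i") auto
    then have "finsum ?R (\<lambda>j. convolution (a j) (x j)) {..<n} = (\<lambda>E. \<Sum>j<n. convolution (a j) (x j) E)"
      by (intro finsum_measure_algebra) auto
    also have "\<dots> = (\<lambda>E. \<Sum>j<n. if j = i then x i E else 0)"
      using conv by (intro ext sum.cong) auto
    also have "\<dots> = x i" using i by simp
    finally have "x i = finsum ?R (\<lambda>j. convolution (a j) (x j)) {..<n}" by (rule sym)
    with a show ?thesis unfolding gen by blast
  qed
  have F: "finite (x ` {..<n})" "x ` {..<n} \<subseteq> augmentation_ideal" using x_aug by auto
  from slowly_varying_exhaustion[OF F] obtain B :: "nat \<Rightarrow> 'a set" where B': "\<forall>k. compact (B k) \<and> 0 \<in> B k"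
    and D: "\<forall>\<mu>\<in>x ` {..<n}. \<exists>D. \<forall>g N. (\<Sum>k<N. cmod (\<mu> {y. g + y \<in> B k})) \<le> D"
    by (elim exE conjE)
  have B: "compact (B k)" "0 \<in> B k" for k using B' by auto
  from not_summable_on_exhaustion[of B, OF noncompact B] obtain f
    where f: "f \<in> augmentation_ideal" and unbounded: "\<forall>D. \<exists>N. D < (\<Sum>k<N. cmod (f (B k)))"
    by (elim bexE)
  have bounded: "\<exists>D. \<forall>N. (\<Sum>k<N. cmod (\<Sum>i<n. convolution (a i) (x i) (B k))) \<le> D"
    if a: "a \<in> {..<n} \<rightarrow> carrier ?R" for a
  proof -
    have "\<exists>D. \<forall>N. (\<Sum>k<N. cmod (convolution (a i) (x i) (B k))) \<le> D" if i: "i < n" for i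
    proof -
      obtain D where D: "\<And>g N. (\<Sum>k<N. cmod (x i {y. g + y \<in> B k})) \<le> D"
        using D[rule_format, of "x i"] i by auto
      have c: "complex_borel_measure (a i)"
        using a i by (auto simp: Pi_iff mem_carrier_measure_algebra)
      obtain C where C: "\<And>E. cmod (a i E) \<le> C"
        using complex_borel_measure_bounded[OF c] by metis
      have "(\<Sum>k<N. cmod (integral_complex_measure (a i) (\<lambda>g. x i {y. g + y \<in> B k}))) \<le> 4 * (D * C)" for N
        by (rule sum_norm_integral_complex_measure_le[OF c C D])
      moreover have "B k \<in> sets borel" for k using B(1) by (rule borel_compact)
      ultimately have "(\<Sum>k<N. cmod (convolution (a i) (x i) (B k))) \<le> 4 * (D * C)" for N
        by (simp add: convolution_def)
      then show ?thesis by blast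
    qed
    then obtain D where D: "\<And>i N. i < n \<Longrightarrow> (\<Sum>k<N. cmod (convolution (a i) (x i) (B k))) \<le> D i" by metis
    have "(\<Sum>k<N. cmod (\<Sum>i<n. convolution (a i) (x i) (B k))) \<le> (\<Sum>i<n. D i)" for N
    proof -
      have "(\<Sum>k<N. cmod (\<Sum>i<n. convolution (a i) (x i) (B k)))
          \<le> (\<Sum>k<N. \<Sum>i<n. cmod (convolution (a i) (x i) (B k)))"
        by (intro sum_mono norm_sum)
      also have "\<dots> = (\<Sum>i<n. \<Sum>k<N. cmod (convolution (a i) (x i) (B k)))"
        by (rule sum.swap)
      also have "\<dots> \<le> (\<Sum>i<n. D i)" by (intro sum_mono D) simp
      finally show ?thesis .
    qed
    then show ?thesis by blast
  qed
  have default: "(\<lambda>E. c * f E) = (THE s. False)" if c: "1 \<le> cmod c" for c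
  proof -
    have "(\<lambda>E. c * f E) \<in> augmentation_ideal"
      using f by (simp add: augmentation_ideal_def carrier_measure_algebra_scale)
    then obtain a where a: "a \<in> {..<n} \<rightarrow> carrier ?R"
      and eq: "(\<lambda>E. c * f E) = finsum ?R (\<lambda>i. convolution (a i) (x i)) {..<n}"
      unfolding gen by blast
    have "(\<lambda>E. c * f E) \<noteq> (\<lambda>E. \<Sum>i<n. convolution (a i) (x i) E)"
    proof
      assume "(\<lambda>E. c * f E) = (\<lambda>E. \<Sum>i<n. convolution (a i) (x i) E)"
      then have *: "(\<Sum>i<n. convolution (a i) (x i) E) = c * f E" for E by metis
      obtain D where D: "\<And>N. (\<Sum>k<N. cmod (c * f (B k))) \<le> D"
        using bounded[OF a] unfolding * by blast
      obtain N where N: "D < (\<Sum>k<N. cmod (f (B k)))" using unbounded by blast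
      have "(\<Sum>k<N. cmod (f (B k))) \<le> (\<Sum>k<N. cmod (c * f (B k)))"
        using c by (intro sum_mono) (simp add: norm_mult mult_le_cancel_right1)
      with N D[of N] show False by linarith
    qed
    with finsum_measure_algebra_cases[of "{..<n}" "\<lambda>i. convolution (a i) (x i)"] eq
    show ?thesis by simp
  qed
  have "1 * f E = 2 * f E" for E
    using fun_cong[OF trans[OF default[of 1] default[of 2, symmetric]], of E] by simp
  then have "f E = 0" for E by simp
  with unbounded[rule_format, of 0] show False by simp
qed

section \<open>The regular measure of a content\<close>

lemma Hausdorff_space_euclidean_t2: "Hausdorff_space (euclidean :: 'a::t2_space topology)"
  unfolding Hausdorff_space_def disjnt_def by simp (metis hausdorff)

text \<open>
  The disjoint compact sets \<open>K - A\<close> and \<open>K - B\<close> have disjoint open neighbourhoods; removing one of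
  them from \<open>K\<close> at a time gives the two parts.
\<close>

lemma closed_subset_Un_open_split:
  fixes K :: "'a::t2_space set"
  assumes G: "compact (UNIV :: 'a set)" and K: "closed K" and AB: "open A" "open B" "K \<subseteq> A \<union> B"
  shows "\<exists>K1 K2. closed K1 \<and> closed K2 \<and> K = K1 \<union> K2 \<and> K1 \<subseteq> A \<and> K2 \<subseteq> B"
proof -
  have cpt: "compact S" if "closed S" for S :: "'a set"
    using compact_Int_closed[OF G that] by simp
  have "compactin euclidean (K - A)" "compactin euclidean (K - B)" "disjnt (K - A) (K - B)"
    using K AB by (auto intro!: cpt closed_Diff simp: disjnt_def)
  then obtain U V where UV: "openin euclidean U" "openin euclidean V" "K - A \<subseteq> U" "K - B \<subseteq> V" "disjnt U V"
    by (rule Hausdorff_space_compact_separation[OF Hausdorff_space_euclidean_t2])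
  have "closed (K - U)" "closed (K - V)" using K UV(1,2) by (auto intro: closed_Diff)
  moreover have "K = (K - U) \<union> (K - V)" using UV(5) by (auto simp: disjnt_def)
  moreover have "K - U \<subseteq> A" "K - V \<subseteq> B" using UV(3,4) by blast+
  ultimately show ?thesis by metis
qed

text \<open>
  Halmos's extension of a content. Its value on an open set is the supremum over closed subsets,
  and on an arbitrary set the infimum over open supersets, which is an outer measure. Every open
  set \<open>U\<close> splits every open set \<open>W\<close> additively: if \<open>K \<subseteq> W \<inter> U\<close> and \<open>L \<subseteq> W - K\<close> are closed, then
  \<open>h K + h L = h (K \<union> L)\<close>, and \<open>W - K\<close> is an open superset of \<open>W - U\<close>. Hence open sets, and so all
  Borel sets, are measurable in the sense of Caratheodory.
\<close>

lemma measure_of_content: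
  fixes h :: "'a::t2_space set \<Rightarrow> real"
  assumes G: "compact (UNIV :: 'a set)"
    and h0: "h {} = 0" and h_nonneg: "\<And>K. 0 \<le> h K"
    and h_mono: "\<And>K L. K \<subseteq> L \<Longrightarrow> h K \<le> h L"
    and h_Un: "\<And>K L. h (K \<union> L) \<le> h K + h L"
    and h_add: "\<And>K L. closed K \<Longrightarrow> closed L \<Longrightarrow> K \<inter> L = {} \<Longrightarrow> h (K \<union> L) = h K + h L"
  shows "\<exists>m. sets m = sets borel \<and>
    (\<forall>U. open U \<longrightarrow> emeasure m U = (SUP K\<in>{K. closed K \<and> K \<subseteq> U}. ennreal (h K))) \<and>
    (\<forall>E\<in>sets borel. emeasure m E = (INF U\<in>{U. open U \<and> E \<subseteq> U}. emeasure m U))"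
proof -
  define f where "f U = (SUP K\<in>{K. closed K \<and> K \<subseteq> U}. ennreal (h K))" for U
  define \<nu> where "\<nu> E = (INF U\<in>{U. open U \<and> E \<subseteq> U}. f U)" for E
  have f_upper: "ennreal (h K) \<le> f U" if "closed K" "K \<subseteq> U" for K U
    unfolding f_def using that by (intro SUP_upper) simp
  have f_least: "f U \<le> c" if "\<And>K. closed K \<Longrightarrow> K \<subseteq> U \<Longrightarrow> ennreal (h K) \<le> c" for U c
    unfolding f_def by (rule SUP_least) (use that in simp)
  have f_mono: "f U \<le> f V" if "U \<subseteq> V" for U V
    by (rule f_least, rule f_upper) (use that in auto)
  have o_lower: "\<nu> E \<le> f U" if "open U" "E \<subseteq> U" for E U
    unfolding \<nu>_def using that by (intro INF_lower) simp
  have o_greatest: "c \<le> \<nu> E" if "\<And>U. open U \<Longrightarrow> E \<subseteq> U \<Longrightarrow> c \<le> f U" for E c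
    unfolding \<nu>_def by (rule INF_greatest) (use that in simp)
  have o_open: "\<nu> U = f U" if "open U" for U
    by (intro antisym o_lower o_greatest f_mono) (use that in auto)
  have o_mono: "\<nu> E \<le> \<nu> F" if "E \<subseteq> F" for E F
    by (rule o_greatest, rule o_lower) (use that in auto)
  have o_empty: "\<nu> {} = 0"
    using o_lower[of "{}" "{}"] f_least[of "{}" 0] h0 by (auto simp: antisym)
  have cover: "ennreal (h K) \<le> (\<Sum>i<n. f (U i))"
    if "\<And>i. open (U i)" "closed K" "K \<subseteq> (\<Union>i<n. U i)" for K n and U :: "nat \<Rightarrow> 'a set"
    using that(2,3)
  proof (induction n arbitrary: K)
    case 0
    then show ?case using h0 by simp
  next
    case (Suc n)
    have "K \<subseteq> (\<Union>i<n. U i) \<union> U n" using Suc.prems(2) unfolding lessThan_Suc by blast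
    moreover have "open (\<Union>i<n. U i)" "open (U n)" using that(1) by auto
    ultimately have "\<exists>K1 K2. closed K1 \<and> closed K2 \<and> K = K1 \<union> K2 \<and> K1 \<subseteq> (\<Union>i<n. U i) \<and> K2 \<subseteq> U n"
      using Suc.prems(1) by (intro closed_subset_Un_open_split[OF G])
    then obtain K1 K2 where K12: "closed K1" "closed K2" "K = K1 \<union> K2" "K1 \<subseteq> (\<Union>i<n. U i)" "K2 \<subseteq> U n"
      by (elim exE conjE)
    have "ennreal (h K) \<le> ennreal (h K1) + ennreal (h K2)"
      unfolding K12(3) using h_Un[of K1 K2] h_nonneg by (simp add: ennreal_leI flip: ennreal_plus)
    also have "\<dots> \<le> (\<Sum>i<n. f (U i)) + f (U n)"
      by (intro add_mono Suc.IH f_upper K12)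
    finally show ?case by simp
  qed
  have f_UN: "f (\<Union>i. U i) \<le> (\<Sum>i. f (U i))" if U: "\<And>i. open (U i)" for U :: "nat \<Rightarrow> 'a set"
  proof (rule f_least)
    fix K assume K: "closed K" "K \<subseteq> (\<Union>i. U i)"
    have "compact K" using compact_Int_closed[OF G K(1)] by simp
    then obtain I where I: "finite I" "K \<subseteq> (\<Union>i\<in>I. U i)"
      by (rule compactE_image[of K UNIV U]) (use U K(2) in auto)
    obtain n where "I \<subseteq> {..<n}" using I(1) finite_nat_iff_bounded by blast
    with I(2) have "K \<subseteq> (\<Union>i<n. U i)" by blast
    with U K(1) have "ennreal (h K) \<le> (\<Sum>i<n. f (U i))" by (intro cover)
    also have "\<dots> \<le> (\<Sum>i. f (U i))" by (intro sum_le_suminf) auto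
    finally show "ennreal (h K) \<le> (\<Sum>i. f (U i))" .
  qed
  have o_UN: "\<nu> (\<Union>i. A i) \<le> (\<Sum>i. \<nu> (A i))" for A :: "nat \<Rightarrow> 'a set"
  proof (rule ennreal_le_epsilon)
    fix e :: real assume fin: "(\<Sum>i. \<nu> (A i)) < top_class.top" and e: "0 < e"
    have "\<exists>U. open U \<and> A i \<subseteq> U \<and> f U \<le> \<nu> (A i) + ennreal (e * (1/2)^Suc i)" for i
    proof -
      have "\<nu> (A i) < top_class.top"
        using sum_le_suminf[of "\<lambda>i. \<nu> (A i)" "{i}"] fin by (auto intro: le_less_trans)
      then have "\<nu> (A i) < \<nu> (A i) + ennreal (e * (1/2)^Suc i)"
        using e by (cases "\<nu> (A i)") (auto simp: ennreal_less_iff simp flip: ennreal_plus)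
      then have "\<exists>U\<in>{U. open U \<and> A i \<subseteq> U}. f U < \<nu> (A i) + ennreal (e * (1/2)^Suc i)"
        unfolding \<nu>_def[of "A i"] by (subst (asm) INF_less_iff)
      then show ?thesis by (auto intro: less_imp_le)
    qed
    then obtain U where U: "\<And>i. open (U i)" "\<And>i. A i \<subseteq> U i"
        "\<And>i. f (U i) \<le> \<nu> (A i) + ennreal (e * (1/2)^Suc i)" by metis
    have "\<nu> (\<Union>i. A i) \<le> f (\<Union>i. U i)"
      by (rule o_lower) (use U(1,2) in auto)
    also have "\<dots> \<le> (\<Sum>i. f (U i))" by (rule f_UN[OF U(1)])
    also have "\<dots> \<le> (\<Sum>i. \<nu> (A i) + ennreal (e * (1/2)^Suc i))"
      by (intro suminf_le U(3)) auto
    also have "\<dots> = (\<Sum>i. \<nu> (A i)) + (\<Sum>i. ennreal (e * (1/2)^Suc i))"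
      by (intro suminf_add[symmetric]) auto
    also have "(\<Sum>i. ennreal (e * (1/2)^Suc i)) = ennreal e"
      using sums_mult[OF power_half_series, of e] e by (intro suminf_ennreal_eq) auto
    finally show "\<nu> (\<Union>i. A i) \<le> (\<Sum>i. \<nu> (A i)) + ennreal e" .
  qed
  interpret sigma_algebra UNIV "UNIV :: 'a set set"
    using sigma_algebra_Pow[of UNIV] by simp
  have oms: "outer_measure_space UNIV \<nu>"
    using o_empty o_mono o_UN
    by (simp add: outer_measure_space_def positive_def increasing_def countably_subadditive_def)
  have ms: "measure_space UNIV (lambda_system UNIV UNIV \<nu>) \<nu>"
    by (rule caratheodory_lemma[OF oms])
  have sub: "\<nu> (A \<union> B) \<le> \<nu> A + \<nu> B" if "A \<inter> B = {}" for A B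
    using countably_subadditive_subadditive[of \<nu>] oms that
    by (auto simp: outer_measure_space_def subadditive_def)
  have open_lambda: "U \<in> lambda_system UNIV UNIV \<nu>" if U: "open U" for U
    unfolding lambda_system_eq
  proof (intro CollectI conjI ballI antisym)
    fix X :: "'a set"
    show "\<nu> X \<le> \<nu> (X \<inter> U) + \<nu> (X - U)"
      using sub[of "X \<inter> U" "X - U"] by (simp add: Int_Diff_Un Int_Diff_disjoint)
    show "\<nu> (X \<inter> U) + \<nu> (X - U) \<le> \<nu> X"
    proof (rule o_greatest)
      fix W assume W: "open W" "X \<subseteq> W"
      have ne: "{K. closed K \<and> K \<subseteq> V} \<noteq> {}" for V :: "'a set" by blast
      have "ennreal (h K) + \<nu> (W - U) \<le> f W" if K: "closed K" "K \<subseteq> W \<inter> U" for K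
      proof -
        have "ennreal (h K) + \<nu> (W - U) \<le> ennreal (h K) + f (W - K)"
          using K W by (intro add_left_mono o_lower open_Diff) auto
        also have "\<dots> = (SUP L\<in>{L. closed L \<and> L \<subseteq> W - K}. ennreal (h K) + ennreal (h L))"
          unfolding f_def by (rule ennreal_SUP_add_right[OF ne])
        also have "\<dots> \<le> f W"
        proof (rule SUP_least)
          fix L assume L: "L \<in> {L. closed L \<and> L \<subseteq> W - K}"
          then have "K \<inter> L = {}" by blast
          with L K(1) have "ennreal (h K) + ennreal (h L) = ennreal (h (K \<union> L))"
            using h_nonneg by (simp add: h_add flip: ennreal_plus)
          also have "\<dots> \<le> f W"
            using L K by (intro f_upper closed_Un) auto
          finally show "ennreal (h K) + ennreal (h L) \<le> f W" .
        qed
        finally show ?thesis .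
      qed
      then have "(SUP K\<in>{K. closed K \<and> K \<subseteq> W \<inter> U}. ennreal (h K) + \<nu> (W - U)) \<le> f W"
        by (intro SUP_least) simp
      then have "f (W \<inter> U) + \<nu> (W - U) \<le> f W"
        unfolding f_def[of "W \<inter> U"] by (subst (asm) ennreal_SUP_add_left[OF ne])
      moreover have "\<nu> (X \<inter> U) + \<nu> (X - U) \<le> f (W \<inter> U) + \<nu> (W - U)"
        using W U by (intro add_mono o_lower o_mono) auto
      ultimately show "\<nu> (X \<inter> U) + \<nu> (X - U) \<le> f W" by (rule order_trans[rotated])
    qed
  qed simp
  have "sigma_algebra UNIV (lambda_system UNIV UNIV \<nu>)"
    using ms by (simp add: measure_space_def)
  then have "sigma_sets UNIV {S. open S} \<subseteq> lambda_system UNIV UNIV \<nu>"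
    by (rule sigma_algebra.sigma_sets_subset) (use open_lambda in blast)
  then have borel_lambda: "sets borel \<subseteq> lambda_system UNIV UNIV \<nu>"
    by (simp add: borel_def)
  have ca: "countably_additive (sets borel) \<nu>"
  proof -
    have "countably_additive (lambda_system UNIV UNIV \<nu>) \<nu>"
      using ms by (simp add: measure_space_def)
    then show ?thesis
      unfolding countably_additive_def using borel_lambda by (meson subset_trans subsetD)
  qed
  define m where "m = measure_of UNIV (sets borel) \<nu>"
  have sets: "sets m = sets borel"
    using sets.sigma_sets_eq[of "borel :: 'a measure"] by (simp add: m_def)
  have em: "emeasure m E = \<nu> E" if "E \<in> sets borel" for E
    by (rule emeasure_measure_of[OF m_def])
      (use that ca o_empty in \<open>auto simp: sets positive_def\<close>)
  have em_open: "emeasure m U = f U" if "open U" for U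
    using that em[of U] o_open[of U] by simp
  have "emeasure m E = (INF U\<in>{U. open U \<and> E \<subseteq> U}. emeasure m U)" if "E \<in> sets borel" for E
    unfolding em[OF that] \<nu>_def using em_open by (intro INF_cong) auto
  with sets em_open show ?thesis
    unfolding f_def by (intro exI[of _ m] conjI allI ballI impI)
qed

section \<open>Haar measure on a compact group\<close>

text \<open>
  The set \<open>{y. - g + y \<in> U}\<close> is the left translate \<open>g + U\<close>, written as a preimage under a continuous
  map.
\<close>

definition covering_number :: "'a::topological_group_add set \<Rightarrow> 'a set \<Rightarrow> nat" where
  "covering_number U K = (LEAST n. \<exists>F. finite F \<and> card F = n \<and> K \<subseteq> (\<Union>g\<in>F. {y. - g + y \<in> U}))"

lemma covering_number_attained:
  fixes U :: "'a::topological_group_add set"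
  assumes G: "compact (UNIV :: 'a set)" and U: "open U" "0 \<in> U"
  shows "\<exists>F. finite F \<and> card F = covering_number U K \<and> K \<subseteq> (\<Union>g\<in>F. {y. - g + y \<in> U})"
proof -
  have "UNIV \<subseteq> (\<Union>g\<in>UNIV. {y. - g + y \<in> U})"
    using U(2) left_minus by (metis (mono_tags, lifting) UN_iff UNIV_I mem_Collect_eq subsetI)
  then obtain F where "finite F" "UNIV \<subseteq> (\<Union>g\<in>F. {y. - g + y \<in> U})"
    by (rule compactE_image[OF G open_left_translate[OF U(1)]])
  then have "\<exists>n F. finite F \<and> card F = n \<and> K \<subseteq> (\<Union>g\<in>F. {y. - g + y \<in> U})" by blast
  then show ?thesis unfolding covering_number_def by (rule LeastI_ex)
qed

lemma covering_number_le:
  assumes "finite F" "K \<subseteq> (\<Union>g\<in>F. {y. - g + y \<in> U})"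
  shows "covering_number U K \<le> card F"
  unfolding covering_number_def using assms by (intro Least_le) blast

lemma covering_number_empty: "covering_number U {} = 0"
  using covering_number_le[of "{}" "{}" U] by simp

lemma covering_number_pos:
  fixes U :: "'a::topological_group_add set"
  assumes "compact (UNIV :: 'a set)" "open U" "0 \<in> U"
  shows "0 < covering_number U UNIV"
proof (rule ccontr)
  assume "\<not> 0 < covering_number U UNIV"
  with covering_number_attained[OF assms, of UNIV]
  obtain F where "finite F" "card F = 0" "UNIV \<subseteq> (\<Union>g\<in>F. {y. - g + y \<in> U})" by auto
  then show False by auto
qed

lemma covering_number_mono:
  fixes U :: "'a::topological_group_add set"
  assumes "compact (UNIV :: 'a set)" "open U" "0 \<in> U" "K \<subseteq> L"
  shows "covering_number U K \<le> covering_number U L"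
proof -
  obtain F where F: "finite F" "card F = covering_number U L" "L \<subseteq> (\<Union>g\<in>F. {y. - g + y \<in> U})"
    using covering_number_attained[OF assms(1-3)] by blast
  then show ?thesis
    using covering_number_le[OF F(1), of K U] assms(4) by auto
qed

lemma covering_number_Un:
  fixes U :: "'a::topological_group_add set"
  assumes "compact (UNIV :: 'a set)" "open U" "0 \<in> U"
  shows "covering_number U (K \<union> L) \<le> covering_number U K + covering_number U L"
proof -
  obtain F where F: "finite F" "card F = covering_number U K" "K \<subseteq> (\<Union>g\<in>F. {y. - g + y \<in> U})"
    using covering_number_attained[OF assms] by blast
  obtain H where H: "finite H" "card H = covering_number U L" "L \<subseteq> (\<Union>g\<in>H. {y. - g + y \<in> U})"
    using covering_number_attained[OF assms] by blast
  have "covering_number U (K \<union> L) \<le> card (F \<union> H)"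
    using F H by (intro covering_number_le) auto
  also have "\<dots> \<le> card F + card H" by (rule card_Un_le)
  finally show ?thesis using F H by simp
qed

lemma covering_number_left_translate:
  fixes U :: "'a::topological_group_add set"
  assumes "compact (UNIV :: 'a set)" "open U" "0 \<in> U"
  shows "covering_number U {y. g + y \<in> K} = covering_number U K"
proof -
  have le: "covering_number U {y. g + y \<in> K} \<le> covering_number U K" for g K
  proof -
    obtain F where F: "finite F" "card F = covering_number U K" "K \<subseteq> (\<Union>g\<in>F. {y. - g + y \<in> U})"
      using covering_number_attained[OF assms] by blast
    have "{y. g + y \<in> K} \<subseteq> (\<Union>k\<in>(\<lambda>k. - g + k) ` F. {y. - k + y \<in> U})"
    proof
      fix y assume "y \<in> {y. g + y \<in> K}"
      then obtain k where "k \<in> F" "- k + (g + y) \<in> U" using F(3) by blast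
      moreover have "- k + (g + y) = - (- g + k) + y" by (simp add: minus_add add.assoc)
      ultimately show "y \<in> (\<Union>k\<in>(\<lambda>k. - g + k) ` F. {y. - k + y \<in> U})" by auto
    qed
    then have "covering_number U {y. g + y \<in> K} \<le> card ((\<lambda>k. - g + k) ` F)"
      using F(1) by (intro covering_number_le) auto
    also have "\<dots> \<le> card F" using F(1) by (rule card_image_le)
    finally show ?thesis using F(2) by simp
  qed
  have "{y. - g + y \<in> {y. g + y \<in> K}} = K" by (simp add: add.assoc[symmetric])
  with le[of "- g" "{y. g + y \<in> K}"] le[of g K] show ?thesis by simp
qed

text \<open>
  If a translate \<open>g + U\<close> contains \<open>k = g + u\<close> and \<open>l = g + v\<close>, then \<open>- l + k = - v + u\<close>. So no translate
  meets both sets, and a minimal cover of the union splits into a cover of each.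
\<close>

lemma covering_number_separated:
  fixes U :: "'a::topological_group_add set"
  assumes "compact (UNIV :: 'a set)" "open U" "0 \<in> U"
    and sep: "\<And>k l u v. k \<in> K \<Longrightarrow> l \<in> L \<Longrightarrow> u \<in> U \<Longrightarrow> v \<in> U \<Longrightarrow> - l + k \<noteq> - v + u"
  shows "covering_number U (K \<union> L) = covering_number U K + covering_number U L"
proof (rule antisym[OF covering_number_Un[OF assms(1-3)]])
  obtain F where F: "finite F" "card F = covering_number U (K \<union> L)"
      "K \<union> L \<subseteq> (\<Union>g\<in>F. {y. - g + y \<in> U})"
    using covering_number_attained[OF assms(1-3)] by blast
  define FK where "FK = {g\<in>F. \<exists>k\<in>K. - g + k \<in> U}"
  define FL where "FL = {g\<in>F. \<exists>l\<in>L. - g + l \<in> U}"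
  have "FK \<inter> FL = {}"
  proof (rule ccontr)
    assume "FK \<inter> FL \<noteq> {}"
    then obtain g k l where "k \<in> K" "l \<in> L" "- g + k \<in> U" "- g + l \<in> U"
      by (auto simp: FK_def FL_def)
    moreover have "- l + k = - (- g + l) + (- g + k)" by (simp add: minus_add add.assoc)
    ultimately show False using sep by blast
  qed
  then have "card FK + card FL = card (FK \<union> FL)"
    using F(1) by (intro card_Un_disjoint[symmetric]) (auto simp: FK_def FL_def)
  also have "\<dots> \<le> card F"
    using F(1) by (intro card_mono) (auto simp: FK_def FL_def)
  finally have "card FK + card FL \<le> covering_number U (K \<union> L)" using F(2) by simp
  moreover have "covering_number U K \<le> card FK"
    using F(1,3) by (intro covering_number_le) (auto simp: FK_def, blast)
  moreover have "covering_number U L \<le> card FL"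
    using F(1,3) by (intro covering_number_le) (auto simp: FL_def, blast)
  ultimately show "covering_number U K + covering_number U L \<le> covering_number U (K \<union> L)" by simp
qed

text \<open>
  The compact set of all \<open>- l + k\<close> with \<open>k \<in> K\<close> and \<open>l \<in> L\<close> does not contain \<open>0\<close>, so by continuity it contains no
  \<open>- v + u\<close> with \<open>u\<close> and \<open>v\<close> close to \<open>0\<close>.
\<close>

lemma disjoint_closed_separated:
  fixes K L :: "'a::{topological_group_add, t2_space} set"
  assumes G: "compact (UNIV :: 'a set)" and KL: "closed K" "closed L" "K \<inter> L = {}"
  shows "\<exists>V. open V \<and> 0 \<in> V \<and> (\<forall>k\<in>K. \<forall>l\<in>L. \<forall>u\<in>V. \<forall>v\<in>V. - l + k \<noteq> - v + u)"
proof -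
  define Q where "Q = (\<lambda>p. - snd p + fst p) ` (K \<times> L)"
  have "compact K" "compact L"
    using compact_Int_closed[OF G KL(1)] compact_Int_closed[OF G KL(2)] by simp_all
  then have "compact Q"
    unfolding Q_def by (intro compact_continuous_image compact_Times continuous_intros)
  then have "open (- Q)" by (intro open_Compl compact_imp_closed)
  moreover have "continuous_on UNIV (\<lambda>p :: 'a \<times> 'a. - snd p + fst p)"
    by (intro continuous_intros)
  ultimately have op: "open ((\<lambda>p. - snd p + fst p) -` (- Q))"
    by (rule open_vimage)
  have "0 \<notin> Q"
  proof
    assume "0 \<in> Q"
    then obtain k l where "k \<in> K" "l \<in> L" "0 = - l + k" by (auto simp: Q_def)
    moreover from this have "k = l" using add_left_imp_eq[of "- l" k l] by simp
    ultimately show False using KL(3) by blast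
  qed
  then have "(0, 0) \<in> (\<lambda>p. - snd p + fst p) -` (- Q)" by simp
  with op obtain A B where AB: "open A" "open B" "(0, 0) \<in> A \<times> B" "A \<times> B \<subseteq> (\<lambda>p. - snd p + fst p) -` (- Q)"
    by (rule open_prod_elim)
  have "- l + k \<noteq> - v + u" if "k \<in> K" "l \<in> L" "u \<in> A \<inter> B" "v \<in> A \<inter> B" for k l u v
  proof -
    have "(u, v) \<in> A \<times> B" using that by simp
    then have "- v + u \<notin> Q" using AB(4) by auto
    moreover have "- l + k \<in> Q" using that unfolding Q_def by (intro image_eqI[of _ _ "(k, l)"]) auto
    ultimately show ?thesis by metis
  qed
  with AB show ?thesis by (intro exI[of _ "A \<inter> B"]) auto
qed

text \<open>
  The normalized covering numbers \<open>(K : U) / (G : U)\<close> are points of the compact space of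
  \<open>[0, 1]\<close>-valued set functions, and \<open>h\<close> is a cluster point as \<open>U\<close> shrinks to \<open>0\<close>. A closed condition
  that holds for all small enough \<open>U\<close> passes to \<open>h\<close>, in particular additivity on disjoint closed
  sets.
\<close>

lemma invariant_content_exists:
  assumes G: "compact (UNIV :: 'a::{topological_group_add, t2_space} set)"
  shows "\<exists>h :: 'a set \<Rightarrow> real. h {} = 0 \<and> h UNIV = 1 \<and> (\<forall>K. 0 \<le> h K) \<and>
    (\<forall>K L. K \<subseteq> L \<longrightarrow> h K \<le> h L) \<and> (\<forall>K L. h (K \<union> L) \<le> h K + h L) \<and>
    (\<forall>g K. h {y. g + y \<in> K} = h K) \<and>
    (\<forall>K L. closed K \<longrightarrow> closed L \<longrightarrow> K \<inter> L = {} \<longrightarrow> h (K \<union> L) = h K + h L)"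
proof -
  define \<phi> where "\<phi> U K = real (covering_number U K) / real (covering_number U UNIV)" for U K :: "'a set"
  define N where "N = {U :: 'a set. open U \<and> 0 \<in> U}"
  define S where "S V = \<phi> ` {U\<in>N. U \<subseteq> V}" for V
  define T where "T = (PiE UNIV (\<lambda>_. {0..1}) :: ('a set \<Rightarrow> real) set)"
  have N: "open U" "0 \<in> U" if "U \<in> N" for U using that by (auto simp: N_def)
  have "compactin (product_topology (\<lambda>_. euclideanreal) UNIV) T"
    unfolding T_def compactin_PiE by simp
  then have T: "compact T"
    unfolding euclidean_product_topology by simp
  have \<phi>_T: "\<phi> U \<in> T" if "U \<in> N" for U
  proof -
    have "covering_number U K \<le> covering_number U UNIV" for K
      by (rule covering_number_mono[OF G N[OF that]]) simp
    then have "\<phi> U K \<in> {0..1}" for K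
      using covering_number_pos[OF G N[OF that]] by (simp add: \<phi>_def)
    then show ?thesis unfolding T_def by (intro PiE_I) auto
  qed
  have "T \<inter> (\<Inter>V\<in>N. closure (S V)) \<noteq> {}"
  proof (rule compact_imp_fip_image[OF T])
    fix I assume I: "finite I" "I \<subseteq> N"
    have "\<Inter>I \<in> N" using I by (auto simp: N_def intro: open_Inter)
    then have "\<phi> (\<Inter>I) \<in> T" "\<phi> (\<Inter>I) \<in> S V" if "V \<in> I" for V
      using that by (auto simp: S_def intro: \<phi>_T)
    then have "\<phi> (\<Inter>I) \<in> T \<inter> (\<Inter>V\<in>I. closure (S V))"
      using \<open>\<Inter>I \<in> N\<close> \<phi>_T closure_subset by blast
    then show "T \<inter> (\<Inter>V\<in>I. closure (S V)) \<noteq> {}" by blast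
  qed simp
  then obtain h where h: "\<And>V. V \<in> N \<Longrightarrow> h \<in> closure (S V)" by blast
  have limit: "h \<in> C" if "closed C" "V \<in> N" "\<And>U. U \<in> N \<Longrightarrow> U \<subseteq> V \<Longrightarrow> \<phi> U \<in> C" for C V
  proof -
    have "S V \<subseteq> C" using that(3) by (auto simp: S_def)
    then have "closure (S V) \<subseteq> C" using that(1) by (rule closure_minimal)
    with h[OF that(2)] show ?thesis by blast
  qed
  have U: "UNIV \<in> N" by (simp add: N_def)
  note cont = continuous_on_product_coordinates continuous_on_const continuous_on_add
  show ?thesis
  proof (intro exI[of _ h] conjI allI impI)
    have "h \<in> {f. f {} = 0}"
    proof (rule limit[OF closed_Collect_eq U])
      show "\<phi> U \<in> {f. f {} = 0}" for U by (simp add: \<phi>_def covering_number_empty)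
    qed (intro cont)+
    then show "h {} = 0" by simp
    have "h \<in> {f. f UNIV = 1}"
    proof (rule limit[OF closed_Collect_eq U])
      fix U assume "U \<in> N"
      from covering_number_pos[OF G N[OF this]]
      show "\<phi> U \<in> {f. f UNIV = 1}" by (simp add: \<phi>_def)
    qed (intro cont)+
    then show "h UNIV = 1" by simp
    fix K L :: "'a set" and g :: 'a
    have "h \<in> {f. 0 \<le> f K}"
    proof (rule limit[OF closed_Collect_le U])
      show "\<phi> U \<in> {f. 0 \<le> f K}" for U by (simp add: \<phi>_def)
    qed (intro cont)+
    then show "0 \<le> h K" by simp
    have "h \<in> {f. f (K \<union> L) \<le> f K + f L}"
    proof (rule limit[OF closed_Collect_le U])
      fix U assume "U \<in> N"
      from covering_number_Un[OF G N[OF this], of K L]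
      have "real (covering_number U (K \<union> L)) \<le> real (covering_number U K) + real (covering_number U L)"
        by linarith
      then show "\<phi> U \<in> {f. f (K \<union> L) \<le> f K + f L}"
        by (simp add: \<phi>_def divide_right_mono flip: add_divide_distrib)
    qed (intro cont)+
    then show "h (K \<union> L) \<le> h K + h L" by simp
    have "h \<in> {f. f {y. g + y \<in> K} = f K}"
    proof (rule limit[OF closed_Collect_eq U])
      fix U assume "U \<in> N"
      from covering_number_left_translate[OF G N[OF this], of g K]
      show "\<phi> U \<in> {f. f {y. g + y \<in> K} = f K}" by (simp add: \<phi>_def)
    qed (intro cont)+
    then show "h {y. g + y \<in> K} = h K" by simp
    show "h K \<le> h L" if "K \<subseteq> L"
    proof -
      have "h \<in> {f. f K \<le> f L}"
      proof (rule limit[OF closed_Collect_le U])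
        fix U assume "U \<in> N"
        from covering_number_mono[OF G N[OF this] \<open>K \<subseteq> L\<close>]
        show "\<phi> U \<in> {f. f K \<le> f L}" by (simp add: \<phi>_def divide_right_mono)
      qed (intro cont)+
      then show ?thesis by simp
    qed
    show "h (K \<union> L) = h K + h L" if KL: "closed K" "closed L" "K \<inter> L = {}"
    proof -
      obtain V where V: "open V" "0 \<in> V" "\<forall>k\<in>K. \<forall>l\<in>L. \<forall>u\<in>V. \<forall>v\<in>V. - l + k \<noteq> - v + u"
        using disjoint_closed_separated[OF G KL] by (elim exE conjE)
      have "h \<in> {f. f (K \<union> L) = f K + f L}"
      proof (rule limit[OF closed_Collect_eq])
        show "V \<in> N" using V by (simp add: N_def)
        fix U assume U: "U \<in> N" "U \<subseteq> V"
        have "covering_number U (K \<union> L) = covering_number U K + covering_number U L"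
          by (rule covering_number_separated[OF G N[OF U(1)]]) (use V(3) U(2) in blast)
        then show "\<phi> U \<in> {f. f (K \<union> L) = f K + f L}"
          by (simp add: \<phi>_def add_divide_distrib)
      qed (intro cont)+
      then show ?thesis by simp
    qed
  qed
qed

text \<open>
  The measure inherits invariance from the content through the supremum over closed sets and the
  infimum over open sets. Inner regularity at \<open>E\<close> is outer regularity at the complement of \<open>E\<close>,
  because closed sets are compact.
\<close>

lemma haar_measure_exists:
  assumes G: "compact (UNIV :: 'a::{topological_group_add, t2_space} set)"
  shows "\<exists>m :: 'a measure. prob_space m \<and> sets m = sets borel \<and>
    (\<forall>g. \<forall>E\<in>sets borel. measure m {y. g + y \<in> E} = measure m E) \<and>
    of_measure m \<in> carrier measure_algebra"
proof -
  from invariant_content_exists[OF G] obtain h :: "'a set \<Rightarrow> real"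
    where "h {} = 0 \<and> h UNIV = 1 \<and> (\<forall>K. 0 \<le> h K) \<and>
      (\<forall>K L. K \<subseteq> L \<longrightarrow> h K \<le> h L) \<and> (\<forall>K L. h (K \<union> L) \<le> h K + h L) \<and>
      (\<forall>g K. h {y. g + y \<in> K} = h K) \<and>
      (\<forall>K L. closed K \<longrightarrow> closed L \<longrightarrow> K \<inter> L = {} \<longrightarrow> h (K \<union> L) = h K + h L)" ..
  then have h: "h {} = 0" "h UNIV = 1" "0 \<le> h K" "K \<subseteq> L \<Longrightarrow> h K \<le> h L"
      "h (K \<union> L) \<le> h K + h L" "h {y. g + y \<in> K} = h K"
      "closed K \<Longrightarrow> closed L \<Longrightarrow> K \<inter> L = {} \<Longrightarrow> h (K \<union> L) = h K + h L" for K L g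
    by simp_all
  have "\<exists>m. sets m = sets borel \<and>
      (\<forall>U. open U \<longrightarrow> emeasure m U = (SUP K\<in>{K. closed K \<and> K \<subseteq> U}. ennreal (h K))) \<and>
      (\<forall>E\<in>sets borel. emeasure m E = (INF U\<in>{U. open U \<and> E \<subseteq> U}. emeasure m U))"
    by (rule measure_of_content[OF G]) (rule h; assumption)+
  then obtain m where sets: "sets m = sets borel"
    and "\<forall>U. open U \<longrightarrow> emeasure m U = (SUP K\<in>{K. closed K \<and> K \<subseteq> U}. ennreal (h K))"
    and "\<forall>E\<in>sets borel. emeasure m E = (INF U\<in>{U. open U \<and> E \<subseteq> U}. emeasure m U)"
    by (elim exE conjE)
  note em_open = this(2)[rule_format] and em = this(3)[rule_format]
  have space: "space m = UNIV" using sets_eq_imp_space_eq[OF sets] by simp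
  have tr_tr: "{y. - g + y \<in> {y. g + y \<in> E}} = E" "{y. g + y \<in> {y. - g + y \<in> E}} = E" for g :: 'a and E
    by (simp_all add: add.assoc[symmetric])
  have "emeasure m UNIV = ennreal 1"
    unfolding em_open[OF open_UNIV]
  proof (rule antisym)
    show "(SUP K\<in>{K. closed K \<and> K \<subseteq> UNIV}. ennreal (h K)) \<le> ennreal 1"
      by (rule SUP_least, rule ennreal_leI) (use h(4)[of _ UNIV] h(2) in simp)
    show "ennreal 1 \<le> (SUP K\<in>{K. closed K \<and> K \<subseteq> UNIV}. ennreal (h K))"
      by (rule SUP_upper2[of UNIV]) (simp_all add: h(2))
  qed
  then have prob: "prob_space m" by (intro prob_spaceI) (simp add: space)
  interpret prob_space m by fact
  have open_le: "emeasure m {y. g + y \<in> U} \<le> emeasure m U" if U: "open U" for g U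
    unfolding em_open[OF U] em_open[OF open_left_translate[OF U]]
  proof (rule SUP_least)
    fix K assume K: "K \<in> {K. closed K \<and> K \<subseteq> {y. g + y \<in> U}}"
    have "{y. - g + y \<in> K} \<subseteq> U"
    proof
      fix y assume "y \<in> {y. - g + y \<in> K}"
      with K have "g + (- g + y) \<in> U" by blast
      then show "y \<in> U" by (simp add: add.assoc[symmetric])
    qed
    moreover have "closed {y. - g + y \<in> K}"
    proof -
      have "open {y. - g + y \<in> - K}" using K by (intro open_left_translate) auto
      moreover have "{y. - g + y \<in> - K} = - {y. - g + y \<in> K}" by auto
      ultimately show ?thesis by (simp add: closed_def)
    qed
    ultimately show "ennreal (h K) \<le> (SUP K\<in>{K. closed K \<and> K \<subseteq> U}. ennreal (h K))"
      by (intro SUP_upper2[of "{y. - g + y \<in> K}"]) (simp_all add: h(6))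
  qed
  have le: "emeasure m {y. g + y \<in> E} \<le> emeasure m E" if E: "E \<in> sets borel" for g E
    unfolding em[OF E]
  proof (rule INF_greatest)
    fix U assume U: "U \<in> {U. open U \<and> E \<subseteq> U}"
    then have "emeasure m {y. g + y \<in> E} \<le> emeasure m {y. g + y \<in> U}"
      using open_left_translate[of U g] by (intro emeasure_mono) (auto simp: sets)
    also have "\<dots> \<le> emeasure m U" using U by (intro open_le) simp
    finally show "emeasure m {y. g + y \<in> E} \<le> emeasure m U" .
  qed
  have inv: "measure m {y. g + y \<in> E} = measure m E" if E: "E \<in> sets borel" for g E
  proof -
    have "emeasure m E \<le> emeasure m {y. g + y \<in> E}"
      using le[OF left_translate_borel[OF E, of g], of "- g"] unfolding tr_tr .
    with le[OF E, of g] have "emeasure m {y. g + y \<in> E} = emeasure m E" by (rule antisym)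
    then show ?thesis by (simp add: measure_def)
  qed
  have outer: "\<exists>U. open U \<and> E \<subseteq> U \<and> measure m (U - E) < e" if E: "E \<in> sets borel" and e: "0 < e" for E e
  proof -
    have "emeasure m E < emeasure m E + ennreal e"
      using e by (simp add: emeasure_eq_measure ennreal_less_iff flip: ennreal_plus)
    then have "\<exists>U\<in>{U. open U \<and> E \<subseteq> U}. emeasure m U < emeasure m E + ennreal e"
      by (subst (asm) em[OF E]) (simp only: INF_less_iff)
    then obtain U where U: "open U" "E \<subseteq> U" "emeasure m U < emeasure m E + ennreal e" by blast
    have "measure m U < measure m E + e"
      using U(3) e by (simp add: emeasure_eq_measure ennreal_less_iff flip: ennreal_plus)
    moreover have "measure m (U - E) = measure m U - measure m E"
      using U(1,2) E by (intro finite_measure_Diff) (auto simp: sets)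
    ultimately show ?thesis using U by (intro exI[of _ U]) simp
  qed
  have "of_measure m \<in> carrier measure_algebra"
  proof (rule of_measure_in_carrier[OF finite_measure_axioms sets])
    fix E :: "'a set" and e :: real assume E: "E \<in> sets borel" and e: "0 < e"
    obtain U where U: "open U" "E \<subseteq> U" "measure m (U - E) < e/2"
      using outer[OF E, of "e/2"] e by auto
    have cE: "- E \<in> sets borel" using E by (rule borel_comp)
    obtain V where V: "open V" "- E \<subseteq> V" "measure m (V - - E) < e/2"
      using outer[OF cE, of "e/2"] e by auto
    have "compact (- V)"
      using compact_Int_closed[OF G closed_Compl[OF V(1)]] by simp
    moreover have "- V \<subseteq> E" using V(2) by blast
    moreover have "measure m (U - - V) < e"
    proof -
      have "measure m (U - - V) \<le> measure m ((U - E) \<union> (V - - E))"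
        using U V E cE by (intro finite_measure_mono) (auto simp: sets)
      also have "\<dots> \<le> measure m (U - E) + measure m (V - - E)"
        using U V E cE by (intro measure_Un_le) (auto simp: sets)
      finally show ?thesis using U(3) V(3) by linarith
    qed
    ultimately show "\<exists>K U. compact K \<and> K \<subseteq> E \<and> open U \<and> E \<subseteq> U \<and> measure m (U - K) < e"
      using U(1,2) by metis
  qed
  with prob sets inv show ?thesis by (intro exI[of _ m] conjI allI ballI)
qed

section \<open>Compactness implies finite generation\<close>

text \<open>
  With \<open>u = \<delta>\<^sub>0 - \<lambda>\<close>, invariance of Haar measure turns the integrand \<open>u(- x + E)\<close> of the convolution
  into \<open>1\<^sub>E(x) - \<lambda>(E)\<close>. Hence right multiplication by \<open>u\<close> maps the algebra into the augmentation
  ideal and is the identity on that ideal.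
\<close>

lemma finitely_generated_if_compact:
  assumes G: "compact (UNIV :: 'a::{topological_group_add, t2_space} set)"
  shows "finitely_generated_left_ideal (measure_algebra :: ('a set \<Rightarrow> complex) ring) augmentation_ideal"
proof -
  let ?R = "measure_algebra :: ('a set \<Rightarrow> complex) ring"
  have mult: "mult ?R = convolution" by (simp add: measure_algebra_def)
  obtain m :: "'a measure" where "prob_space m" and sets: "sets m = sets borel"
    and "\<forall>g. \<forall>E\<in>sets borel. measure m {y. g + y \<in> E} = measure m E"
    and haar: "of_measure m \<in> carrier ?R"
    using haar_measure_exists[OF G] by (elim exE conjE)
  note inv = this(3)[rule_format]
  interpret prob_space m by fact
  have haar_UNIV: "of_measure m UNIV = 1"
    using prob_space sets_eq_imp_space_eq[OF sets] by (simp add: of_measure_def)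
  define u where "u = (\<lambda>E. point_mass (0::'a) E + (-1) * of_measure m E)"
  have u: "u \<in> carrier ?R"
    unfolding u_def
    by (intro carrier_measure_algebra_add carrier_measure_algebra_scale point_mass_in_carrier haar)
  have conv: "convolution a u = (\<lambda>E. a E + (- a UNIV) * of_measure m E)" if a: "a \<in> carrier ?R" for a
  proof
    fix E :: "'a set"
    have c: "complex_borel_measure a" using a by (simp add: mem_carrier_measure_algebra)
    show "convolution a u E = a E + (- a UNIV) * of_measure m E"
    proof (cases "E \<in> sets borel")
      case True
      have "u {y. x + y \<in> E} = indicator E x + (- of_measure m E)" for x
        using inv[OF True, of x] left_translate_borel[OF True, of x]
        by (simp add: u_def point_mass_def of_measure_def indicator_def)
      then have "convolution a u E = integral_complex_measure a (\<lambda>x. indicator E x + (- of_measure m E))"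
        using True by (simp add: convolution_def)
      also have "\<dots> = a E + (- of_measure m E) * a UNIV"
        by (rule integral_complex_measure_affine_indicator[OF c True])
      finally show ?thesis by simp
    next
      case False
      then show ?thesis
        using c sets by (simp add: convolution_def complex_borel_measure_def of_measure_def measure_notin_sets)
    qed
  qed
  have conv_carrier: "convolution a u \<in> carrier ?R" if a: "a \<in> carrier ?R" for a
    unfolding conv[OF a] by (intro carrier_measure_algebra_add carrier_measure_algebra_scale a haar)
  have sum: "finsum ?R (\<lambda>i. convolution (a i) u) {..<1} = convolution (a 0) u"
    if "a 0 \<in> carrier ?R" for a :: "nat \<Rightarrow> 'a set \<Rightarrow> complex"
    using that conv_carrier by (subst finsum_measure_algebra) auto
  have "augmentation_ideal = {finsum ?R (\<lambda>i. convolution (a i) u) {..<1} | a :: nat \<Rightarrow> _. a \<in> {..<1} \<rightarrow> carrier ?R}"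
  proof (intro equalityI subsetI)
    fix \<mu> :: "'a set \<Rightarrow> complex" assume "\<mu> \<in> augmentation_ideal"
    then have \<mu>: "\<mu> \<in> carrier ?R" "\<mu> UNIV = 0" by (auto simp: augmentation_ideal_def)
    have "finsum ?R (\<lambda>i. convolution ((\<lambda>_. \<mu>) i) u) {..<1::nat} = convolution \<mu> u"
      using sum[of "\<lambda>_. \<mu>", OF \<mu>(1)] .
    also have "\<dots> = \<mu>" using conv[OF \<mu>(1)] \<mu>(2) by simp
    finally have "\<mu> = finsum ?R (\<lambda>i. convolution ((\<lambda>_. \<mu>) i) u) {..<1::nat}" by (rule sym)
    moreover have "(\<lambda>_. \<mu>) \<in> {..<1::nat} \<rightarrow> carrier ?R" using \<mu>(1) by simp
    ultimately show "\<mu> \<in> {finsum ?R (\<lambda>i. convolution (a i) u) {..<1} | a :: nat \<Rightarrow> _. a \<in> {..<1} \<rightarrow> carrier ?R}"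
      by (intro CollectI exI[of _ "\<lambda>_. \<mu>"] conjI)
  next
    fix \<mu> assume "\<mu> \<in> {finsum ?R (\<lambda>i. convolution (a i) u) {..<1} | a :: nat \<Rightarrow> _. a \<in> {..<1} \<rightarrow> carrier ?R}"
    then obtain a :: "nat \<Rightarrow> 'a set \<Rightarrow> complex"
      where a: "a \<in> {..<1} \<rightarrow> carrier ?R" "\<mu> = finsum ?R (\<lambda>i. convolution (a i) u) {..<1}" by blast
    then have a0: "a 0 \<in> carrier ?R" by auto
    have "\<mu> = convolution (a 0) u" using a(2) sum[of a, OF a0] by (rule trans)
    then show "\<mu> \<in> augmentation_ideal"
      using conv_carrier[OF a0] conv[OF a0] haar_UNIV by (simp add: augmentation_ideal_def)
  qed
  then show ?thesis
    unfolding finitely_generated_left_ideal_def mult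
    by (intro exI[of _ "1::nat"] exI[of _ "\<lambda>_. u"] conjI) (use u in simp_all)
qed

theorem theorem3p5:
  assumes "locally compact (UNIV :: 'a::{topological_group_add, t2_space} set)"
  shows "finitely_generated_left_ideal (measure_algebra :: ('a set \<Rightarrow> complex) ring) augmentation_ideal
           \<longleftrightarrow> compact (UNIV :: 'a set)"
  using compact_if_finitely_generated finitely_generated_if_compact by blast

end
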